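(* Let $n\ge 1$ be an integer, let $\delta\in(0,\pi)$, and let $k\ge 0$ be an integer. If $\operatorname{conn}(\check{C}(S^n;\pi-\delta))=k-1$, then \[\operatorname{cov}_{S^n}(2k+2)\le \delta\le 2\operatorname{cov}_{S^n}(k+1).\]
   Context: $S^n=\{x\in\mathbb{R}^{n+1} : \|x\|=1\}$ is equipped with the geodesic metric $d(x,y)=\arccos(x\cdot y)\in[0,\pi]$, so it has diameter $\pi$. For a metric space $(X,d)$, write $B(x,r)=\{y\in X : d(y,x)<r\}$ and $B[x,r]=\{y\in X : d(y,x)\le r\}$ for the open and closed balls. Čech complex: for $r>0$, $\check{C}(X;r)$ is the (intrinsic) nerve of the family of open balls $\{B(x,r)\}_{x\in X}$, i.e. the (possibly infinite) simplicial complex with vertex set $X$ in which a finite nonempty subset $\sigma\subseteq X$ is a simplex if and only if $\bigcap_{x\in\sigma}B(x,r)\neq\emptyset$. Simplicial complexes are identified with their geometric realizations. Connectivity: for a nonempty topological space $Y$, $\operatorname{conn}(Y)$ is the maximal $k$ such that $\pi_i(Y)$ is trivial for all $i\le k$ (so $\operatorname{conn}(Y)=-1$ if $Y$ is nonempty and not path-connected, and $\operatorname{conn}(Y)=\infty$ if all homotopy groups are trivial). Covering radius: for an integer $m\ge 1$, $\operatorname{cov}_X(m)$ is the infimum of all $r\ge 0$ such that there exist $x_1,\dots,x_m\in X$ with $\bigcup_{i=1}^m B[x_i,r]=X$. *)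

theory Defs
  imports "HOL-Analysis.Analysis"
begin

section \<open>The geodesic metric on the unit sphere\<close>

text \<open>The type of metrics demands a function that is nonnegative and symmetric on the whole
  type, while \<^const>\<open>arccos\<close> is unspecified outside \<open>[-1, 1]\<close>; hence the value 0 off the sphere.\<close>

definition geodesic_dist :: "'a::real_inner \<Rightarrow> 'a \<Rightarrow> real" where
  "geodesic_dist x y = (if x \<in> sphere 0 1 \<and> y \<in> sphere 0 1 then arccos (x \<bullet> y) else 0)"

definition geodesic_sphere :: "'a::real_inner metric" where
  "geodesic_sphere = metric (sphere 0 1, geodesic_dist)"

lemma inner_sphere_bounds:
  fixes x y :: "'a::real_inner"
  assumes "x \<in> sphere 0 1" "y \<in> sphere 0 1"
  shows "-1 \<le> x \<bullet> y" "x \<bullet> y \<le> 1"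
  using Cauchy_Schwarz_ineq2[of x y] assms by auto

lemma inner_ge_cos_arccos_add:
  fixes a b c :: "'a::real_inner"
  assumes "a \<in> sphere 0 1" "b \<in> sphere 0 1" "c \<in> sphere 0 1"
  shows "cos (arccos (a \<bullet> b) + arccos (b \<bullet> c)) \<le> a \<bullet> c"
proof -
  let ?p = "a \<bullet> b" and ?q = "b \<bullet> c"
  let ?u = "a - ?p *\<^sub>R b" and ?v = "c - ?q *\<^sub>R b"
  have n: "a \<bullet> a = 1" "b \<bullet> b = 1" "c \<bullet> c = 1"
    using assms by (auto simp: norm_eq_1)
  have b: "-1 \<le> ?p" "?p \<le> 1" "-1 \<le> ?q" "?q \<le> 1"
    using inner_sphere_bounds assms by blast+
  have uv: "?u \<bullet> ?v = a \<bullet> c - ?p * ?q"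
    using n by (simp add: algebra_simps inner_commute)
  have "?u \<bullet> ?u = 1 - ?p\<^sup>2" "?v \<bullet> ?v = 1 - ?q\<^sup>2"
    using n by (simp_all add: algebra_simps inner_commute power2_eq_square)
  then have "norm ?u = sqrt (1 - ?p\<^sup>2)" "norm ?v = sqrt (1 - ?q\<^sup>2)"
    by (simp_all add: norm_eq_sqrt_inner)
  then have "- (sqrt (1 - ?p\<^sup>2) * sqrt (1 - ?q\<^sup>2)) \<le> ?u \<bullet> ?v"
    using Cauchy_Schwarz_ineq2[of ?u ?v] by auto
  then show ?thesis
    using b uv by (simp add: cos_add sin_arccos)
qed

lemma Metric_space_geodesic: "Metric_space (sphere 0 1 :: 'a::real_inner set) geodesic_dist"
proof
  fix x y :: 'a
  show "0 \<le> geodesic_dist x y"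
    by (simp add: geodesic_dist_def arccos_lbound inner_sphere_bounds)
  show "geodesic_dist x y = geodesic_dist y x"
    by (auto simp: geodesic_dist_def inner_commute)
next
  fix x y :: 'a
  assume xy: "x \<in> sphere 0 1" "y \<in> sphere 0 1"
  have "arccos (x \<bullet> y) = 0 \<longleftrightarrow> x \<bullet> y = 1"
    using inner_sphere_bounds[OF xy] by (metis arccos_1 cos_arccos cos_zero)
  also have "\<dots> \<longleftrightarrow> x = y"
  proof
    assume "x \<bullet> y = 1"
    moreover have "x \<bullet> x = 1" "y \<bullet> y = 1"
      using xy by (auto simp: norm_eq_1)
    ultimately have "(x - y) \<bullet> (x - y) = 0"
      by (simp add: inner_diff inner_commute)
    then show "x = y" by simp
  next
    assume "x = y"
    then show "x \<bullet> y = 1" using xy by (auto simp: norm_eq_1)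
  qed
  finally show "geodesic_dist x y = 0 \<longleftrightarrow> x = y"
    using xy by (simp add: geodesic_dist_def)
next
  fix x y z :: 'a
  assume s: "x \<in> sphere 0 1" "y \<in> sphere 0 1" "z \<in> sphere 0 1"
  let ?s = "arccos (x \<bullet> y) + arccos (y \<bullet> z)"
  have "arccos (x \<bullet> z) \<le> ?s"
  proof (cases "?s \<le> pi")
    case True
    have "0 \<le> ?s"
      using s by (simp add: add_nonneg_nonneg arccos_lbound inner_sphere_bounds)
    then have "?s = arccos (cos ?s)"
      using True by (simp add: arccos_cos)
    also have "arccos (x \<bullet> z) \<le> arccos (cos ?s)"
      using inner_ge_cos_arccos_add[OF s] inner_sphere_bounds[OF s(1,3)]
      by (simp add: arccos_le_mono)
    finally show ?thesis by simp
  next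
    case False
    have "arccos (x \<bullet> z) \<le> pi"
      using s by (simp add: arccos_ubound inner_sphere_bounds)
    then show ?thesis using False by linarith
  qed
  then show "geodesic_dist x z \<le> geodesic_dist x y + geodesic_dist y z"
    using s by (simp add: geodesic_dist_def)
qed

lemma mspace_geodesic_sphere [simp]: "mspace geodesic_sphere = sphere 0 1"
  by (simp add: geodesic_sphere_def Metric_space.mspace_metric[OF Metric_space_geodesic])

lemma mdist_geodesic_sphere [simp]:
  "\<lbrakk>x \<in> sphere 0 1; y \<in> sphere 0 1\<rbrakk> \<Longrightarrow> mdist geodesic_sphere x y = arccos (x \<bullet> y)"
  by (simp add: geodesic_sphere_def Metric_space.mdist_metric[OF Metric_space_geodesic]
      geodesic_dist_def)

section \<open>Covering radius\<close>

definition covering_radius :: "'a metric \<Rightarrow> nat \<Rightarrow> real" where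
  "covering_radius X m =
     Inf {r. 0 \<le> r \<and> (\<exists>x :: nat \<Rightarrow> 'a. (\<forall>i\<in>{1..m}. x i \<in> mspace X) \<and>
                             (\<Union>i\<in>{1..m}. mcball_of X (x i) r) = mspace X)}"

section \<open>Simplicial complexes and their geometric realizations\<close>

text \<open>An abstract simplicial complex is given by its set of (finite nonempty) simplices.\<close>

definition cech_complex :: "'a metric \<Rightarrow> real \<Rightarrow> 'a set set" where
  "cech_complex X r =
     {\<sigma>. finite \<sigma> \<and> \<sigma> \<noteq> {} \<and> \<sigma> \<subseteq> mspace X \<and> (\<Inter>x\<in>\<sigma>. mball_of X x r) \<noteq> {}}"

text \<open>The closed simplex \<open>|\<sigma>|\<close>, in barycentric coordinates extended by zero.\<close>

definition closed_simplex :: "'a set \<Rightarrow> ('a \<Rightarrow> real) set" where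
  "closed_simplex \<sigma> = {t. (\<forall>v. 0 \<le> t v) \<and> (\<forall>v. v \<notin> \<sigma> \<longrightarrow> t v = 0) \<and> sum t \<sigma> = 1}"

text \<open>The realization carries the weak (coherent) topology. On each closed simplex, where only
  finitely many coordinates can be nonzero, the product topology is the Euclidean one.\<close>

definition geometric_realization :: "'a set set \<Rightarrow> ('a \<Rightarrow> real) topology" where
  "geometric_realization K =
     topology (\<lambda>U. U \<subseteq> (\<Union>\<sigma>\<in>K. closed_simplex \<sigma>) \<and>
       (\<forall>\<sigma>\<in>K. openin (subtopology (powertop_real UNIV) (closed_simplex \<sigma>))
                     (U \<inter> closed_simplex \<sigma>)))"

lemma openin_geometric_realization:
  "openin (geometric_realization K) U \<longleftrightarrow>
     U \<subseteq> (\<Union>\<sigma>\<in>K. closed_simplex \<sigma>) \<and>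
     (\<forall>\<sigma>\<in>K. openin (subtopology (powertop_real UNIV) (closed_simplex \<sigma>)) (U \<inter> closed_simplex \<sigma>))"
proof -
  let ?L = "\<lambda>U. U \<subseteq> (\<Union>\<sigma>\<in>K. closed_simplex \<sigma>) \<and>
     (\<forall>\<sigma>\<in>K. openin (subtopology (powertop_real UNIV) (closed_simplex \<sigma>)) (U \<inter> closed_simplex \<sigma>))"
  have "istopology ?L"
    unfolding istopology_def
  proof (intro conjI allI impI)
    fix S T assume "?L S" "?L T"
    then show "S \<inter> T \<subseteq> (\<Union>\<sigma>\<in>K. closed_simplex \<sigma>)" by blast
    show "\<forall>\<sigma>\<in>K. openin (subtopology (powertop_real UNIV) (closed_simplex \<sigma>))
            (S \<inter> T \<inter> closed_simplex \<sigma>)"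
    proof
      fix \<sigma> assume "\<sigma> \<in> K"
      moreover have "S \<inter> T \<inter> closed_simplex \<sigma> = (S \<inter> closed_simplex \<sigma>) \<inter> (T \<inter> closed_simplex \<sigma>)"
        by blast
      ultimately show "openin (subtopology (powertop_real UNIV) (closed_simplex \<sigma>))
            (S \<inter> T \<inter> closed_simplex \<sigma>)"
        using \<open>?L S\<close> \<open>?L T\<close> by (metis openin_Int)
    qed
  next
    fix \<U> assume \<U>: "\<forall>S\<in>\<U>. ?L S"
    then show "\<Union>\<U> \<subseteq> (\<Union>\<sigma>\<in>K. closed_simplex \<sigma>)" by blast
    show "\<forall>\<sigma>\<in>K. openin (subtopology (powertop_real UNIV) (closed_simplex \<sigma>))
            (\<Union>\<U> \<inter> closed_simplex \<sigma>)"
      using \<U> by (auto simp only: Int_Union2 intro!: openin_Union)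
  qed
  then show ?thesis
    by (simp add: geometric_realization_def topology_inverse')
qed

lemma topspace_geometric_realization:
  "topspace (geometric_realization K) = (\<Union>\<sigma>\<in>K. closed_simplex \<sigma>)"
proof
  show "topspace (geometric_realization K) \<subseteq> (\<Union>\<sigma>\<in>K. closed_simplex \<sigma>)"
    using openin_geometric_realization[of K "topspace (geometric_realization K)"] by simp
  have "openin (geometric_realization K) (\<Union>\<sigma>\<in>K. closed_simplex \<sigma>)"
    unfolding openin_geometric_realization
  proof (intro conjI ballI order_refl)
    fix \<tau> assume "\<tau> \<in> K"
    then have "(\<Union>\<sigma>\<in>K. closed_simplex \<sigma>) \<inter> closed_simplex \<tau> = closed_simplex \<tau>"
      by blast
    then show "openin (subtopology (powertop_real UNIV) (closed_simplex \<tau>))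
            ((\<Union>\<sigma>\<in>K. closed_simplex \<sigma>) \<inter> closed_simplex \<tau>)"
      by (simp add: openin_subtopology_refl)
  qed
  then show "(\<Union>\<sigma>\<in>K. closed_simplex \<sigma>) \<subseteq> topspace (geometric_realization K)"
    by (rule openin_subset)
qed

section \<open>Homotopy groups and connectivity\<close>

definition nsphere_base :: "nat \<Rightarrow> real" where
  "nsphere_base = (\<lambda>j. if j = 0 then 1 else 0)"

definition based_maps :: "nat \<Rightarrow> 'b topology \<Rightarrow> 'b \<Rightarrow> ((nat \<Rightarrow> real) \<Rightarrow> 'b) set" where
  "based_maps i Y y = {f. continuous_map (nsphere i) Y f \<and> f nsphere_base = y}"

text \<open>The underlying set of \<open>\<pi>\<^sub>i(Y, y)\<close>: based maps from the \<open>i\<close>-sphere modulo based homotopy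
  (for \<open>i = 0\<close>, the set of path components). A group is trivial iff this set is a singleton,
  so the group operation is not needed.\<close>

definition homotopy_group_carrier ::
    "nat \<Rightarrow> 'b topology \<Rightarrow> 'b \<Rightarrow> ((nat \<Rightarrow> real) \<Rightarrow> 'b) set set" where
  "homotopy_group_carrier i Y y =
     based_maps i Y y // {(f, g). homotopic_with (\<lambda>h. h nsphere_base = y) (nsphere i) Y f g}"

definition trivial_homotopy_group :: "nat \<Rightarrow> 'b topology \<Rightarrow> bool" where
  "trivial_homotopy_group i Y \<longleftrightarrow>
     (\<forall>y\<in>topspace Y. is_singleton (homotopy_group_carrier i Y y))"

text \<open>For nonempty \<open>Y\<close>. The condition is vacuous for \<open>k = -1\<close> and downward closed in \<open>k\<close>, so the
  supremum is the maximal such \<open>k\<close> if there is one, and \<open>\<infinity>\<close> otherwise.\<close>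

definition conn :: "'b topology \<Rightarrow> ereal" where
  "conn Y = Sup {ereal (real_of_int k) |k::int. -1 \<le> k \<and>
                   (\<forall>i::nat. int i \<le> k \<longrightarrow> trivial_homotopy_group i Y)}"

lemma nsphere_base_in_nsphere: "nsphere_base \<in> topspace (nsphere i)"
  by (simp add: nsphere nsphere_base_def if_distrib [where f="\<lambda>x. x ^ 2"] sum.delta cong: if_cong)

lemma equiv_based_homotopy:
  "equiv (based_maps i Y y)
     {(f, g). homotopic_with (\<lambda>h. h nsphere_base = y) (nsphere i) Y f g}"
proof (rule equivI)
  let ?R = "{(f, g). homotopic_with (\<lambda>h. h nsphere_base = y) (nsphere i) Y f g}"
  show "?R \<subseteq> based_maps i Y y \<times> based_maps i Y y"
  proof clarify
    fix f g assume *: "homotopic_with (\<lambda>h. h nsphere_base = y) (nsphere i) Y f g"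
    show "f \<in> based_maps i Y y \<and> g \<in> based_maps i Y y"
      using homotopic_with_imp_continuous_maps[OF *] homotopic_with_imp_property[OF *]
      by (simp add: based_maps_def)
  qed
  show "refl_on (based_maps i Y y) ?R"
    by (simp add: refl_on_def based_maps_def)
  show "sym ?R"
    by (rule symI) (simp add: homotopic_with_sym)
  show "trans ?R"
    by (rule transI) (simp, rule homotopic_with_trans)
qed

end

theory Submission
  imports Defs "HOL-Homology.Homology"
begin

text \<open>
  A point \<open>z\<close> has distance less than \<open>pi - \<delta>\<close> from \<open>x\<close> iff its antipode has distance more than
  \<open>\<delta>\<close> from \<open>x\<close>. Hence a finite nonempty set \<open>\<sigma>\<close> is a simplex of the Cech complex at scale
  \<open>pi - \<delta>\<close> iff the closed \<open>\<delta>\<close>-balls around \<open>\<sigma>\<close> fail to cover the sphere. In other words, the Cech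
  complex is the neighbourhood complex of the Borsuk graph, in which two points are adjacent when
  their distance exceeds \<open>\<delta>\<close>. Both inequalities are read off from this.

  Lower bound. If no \<open>2 k + 2\<close> closed \<open>\<delta>\<close>-balls cover the sphere, then every set of at most
  \<open>2 k + 2\<close> points is a simplex. A map from the \<open>i\<close>-sphere, \<open>i \<le> k\<close>, can be approximated by one whose
  values have at most \<open>i + 1\<close> nonzero coordinates (\<open>low_dimensional_approximation\<close>), and this map
  can be coned off to a vertex, since \<open>i + 2 \<le> 2 k + 2\<close>. So \<open>\<pi>\<^sub>i\<close> vanishes for all \<open>i \<le> k\<close>, and
  the connectivity is at least \<open>k\<close>, not \<open>k - 1\<close>.

  Upper bound. If \<open>k + 1\<close> closed balls of radius \<open>r < \<delta> / 2\<close> cover the sphere, then colouring each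
  point by a ball that contains it is a proper colouring of the Borsuk graph with \<open>k + 1\<close> colours,
  because the balls have diameter at most \<open>2 r < \<delta>\<close>. By the theorem of Lovasz (\<open>Lovasz_bound\<close>), a graph
  whose neighbourhood complex is \<open>(k - 1)\<close>-connected has no such colouring. The proof of that theorem
  builds, by induction on the dimension, a map \<open>s\<close> from the \<open>k\<close>-sphere to the neighbourhood complex such
  that all vertices of the carrier of \<open>s x\<close> are adjacent to all vertices of the carrier of \<open>s (- x)\<close>.
  For each colour take the total weight of that colour in \<open>s x\<close> minus that in \<open>s (- x)\<close>. These are
  \<open>k + 1\<close> odd functions with sum zero, so by Borsuk--Ulam they have a common zero, at which a colour
  that occurs in \<open>s x\<close> also occurs in \<open>s (- x)\<close>, on an adjacent vertex.

  The Borsuk--Ulam theorem itself is proved by a cup-length argument on singular chains: \<open>k\<close> odd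
  functions without a common zero on the \<open>k\<close>-sphere would give \<open>k\<close> cocycles, one of which vanishes on
  each set of an open cover, whose product is nonetheless odd on a suitable chain.
\<close>

section \<open>Simplicial complexes: maps given by weights\<close>

locale abstract_complex =
  fixes K :: "'v set set"
  assumes finite_simplex: "\<sigma> \<in> K \<Longrightarrow> finite \<sigma>"
    and simplex_nonempty: "\<sigma> \<in> K \<Longrightarrow> \<sigma> \<noteq> {}"
    and face_simplex: "\<lbrakk>\<sigma> \<in> K; \<tau> \<subseteq> \<sigma>; \<tau> \<noteq> {}\<rbrakk> \<Longrightarrow> \<tau> \<in> K"

abbreviation support :: "('v \<Rightarrow> real) \<Rightarrow> 'v set" where
  "support t \<equiv> {v. 0 < t v}"

text \<open>Barycentric coordinates up to scaling. Homotopies and joins are easiest to write down without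
  keeping the coordinate sum equal to 1: nonnegative coordinates only have to be continuous one by
  one, and the support decides in which simplex the point lies. The finite set of possible vertices
  reduces continuity for the weak topology to continuity of the coordinates.\<close>

definition weight_map :: "'x topology \<Rightarrow> 'v set set \<Rightarrow> ('x \<Rightarrow> 'v \<Rightarrow> real) \<Rightarrow> bool" where
  "weight_map X K g \<longleftrightarrow>
     (\<exists>W. finite W \<and> (\<forall>x\<in>topspace X. support (g x) \<subseteq> W)) \<and>
     (\<forall>x\<in>topspace X. (\<forall>v. 0 \<le> g x v) \<and> support (g x) \<in> K) \<and>
     (\<forall>v. continuous_map X euclideanreal (\<lambda>x. g x v))"

lemma weight_mapI:
  assumes "finite W" "\<And>x. x \<in> topspace X \<Longrightarrow> support (g x) \<subseteq> W"
    and "\<And>x. x \<in> topspace X \<Longrightarrow> support (g x) \<in> K"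
    and "\<And>x v. x \<in> topspace X \<Longrightarrow> 0 \<le> g x v"
    and "\<And>v. continuous_map X euclideanreal (\<lambda>x. g x v)"
  shows "weight_map X K g"
  unfolding weight_map_def using assms by (intro conjI ballI allI exI[of _ W])

definition barycentric :: "('v \<Rightarrow> real) \<Rightarrow> 'v \<Rightarrow> real" where
  "barycentric t = (\<lambda>v. t v / sum t (support t))"

lemma barycentric_id: "sum t (support t) = 1 \<Longrightarrow> barycentric t = t"
  by (simp add: barycentric_def)

lemma sum_support: "\<lbrakk>finite W; support t \<subseteq> W; \<And>v. 0 \<le> t v\<rbrakk> \<Longrightarrow> sum t (support t) = sum t W"
  by (rule sum.mono_neutral_left) (auto simp: order_less_le)

text \<open>Both constructions of maps below put weights \<open>\<rho> p\<close> on auxiliary indices \<open>p\<close> and move the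
  weight of \<open>p\<close> to a vertex \<open>f p\<close>.\<close>

lemma support_fibre_sum:
  assumes "finite L" "\<And>p. p \<in> L \<Longrightarrow> 0 \<le> \<rho> p"
  shows "support (\<lambda>v. \<Sum>p\<in>{p \<in> L. f p = v}. \<rho> p) = f ` {p \<in> L. (0::real) < \<rho> p}"
proof -
  have "0 < (\<Sum>p\<in>{p \<in> L. f p = v}. \<rho> p) \<longleftrightarrow> (\<Sum>p\<in>{p \<in> L. f p = v}. \<rho> p) \<noteq> 0" for v
    using sum_nonneg[of "{p \<in> L. f p = v}" \<rho>] assms(2) by force
  moreover have "(\<Sum>p\<in>{p \<in> L. f p = v}. \<rho> p) = 0 \<longleftrightarrow> (\<forall>p\<in>{p \<in> L. f p = v}. \<rho> p = 0)" for v
    using assms by (intro sum_nonneg_eq_0_iff) auto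
  ultimately show ?thesis
    using assms(2) by (force simp: less_le)
qed

context abstract_complex
begin

lemma sum_support_pos:
  assumes "support t \<in> K"
  shows "0 < sum t (support t)"
  using finite_simplex[OF assms] simplex_nonempty[OF assms] by (intro sum_pos) auto

lemma support_barycentric [simp]: "support t \<in> K \<Longrightarrow> support (barycentric t) = support t"
  using sum_support_pos[of t] by (auto simp: barycentric_def zero_less_divide_iff)

lemma mem_realization:
  "t \<in> topspace (geometric_realization K) \<longleftrightarrow>
     (\<forall>v. 0 \<le> t v) \<and> support t \<in> K \<and> sum t (support t) = 1"
proof
  assume "t \<in> topspace (geometric_realization K)"
  then obtain \<sigma> where s: "\<sigma> \<in> K" "t \<in> closed_simplex \<sigma>"
    by (auto simp: topspace_geometric_realization)
  then have nn: "\<And>v. 0 \<le> t v" and sub: "support t \<subseteq> \<sigma>" and one: "sum t \<sigma> = 1"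
    by (auto simp: closed_simplex_def less_le)
  have "sum t (support t) = 1"
    using sum_support[OF finite_simplex[OF s(1)] sub nn] one by simp
  moreover from this have "support t \<noteq> {}" by (metis sum.empty zero_neq_one)
  ultimately show "(\<forall>v. 0 \<le> t v) \<and> support t \<in> K \<and> sum t (support t) = 1"
    using nn face_simplex[OF s(1) sub] by blast
next
  assume "(\<forall>v. 0 \<le> t v) \<and> support t \<in> K \<and> sum t (support t) = 1"
  then show "t \<in> topspace (geometric_realization K)"
    by (auto simp: topspace_geometric_realization closed_simplex_def order_less_le intro!: bexI[of _ "support t"])
qed

lemma mem_closed_simplex_iff:
  assumes "t \<in> topspace (geometric_realization K)" "finite \<sigma>"
  shows "t \<in> closed_simplex \<sigma> \<longleftrightarrow> support t \<subseteq> \<sigma>"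
proof
  assume "support t \<subseteq> \<sigma>"
  then show "t \<in> closed_simplex \<sigma>"
    using assms sum_support[of \<sigma> t] by (auto simp: mem_realization closed_simplex_def order_less_le)
qed (auto simp: closed_simplex_def less_le)

text \<open>If all coordinates were at most \<open>1 / (card W + 1)\<close>, they could not add up to 1. This yields one
  threshold that works for all points of a finite subcomplex.\<close>

lemma large_coordinate:
  assumes t: "t \<in> topspace (geometric_realization K)" and W: "finite W" "support t \<subseteq> W"
  shows "\<exists>v\<in>W. 1 / (real (card W) + 1) < t v"
proof (rule ccontr)
  assume "\<not> ?thesis"
  then have "sum t W \<le> of_nat (card W) * (1 / (real (card W) + 1))"
    by (intro sum_bounded_above) (auto simp: not_less)
  also have "\<dots> < 1"
    by (simp add: field_simps)
  also have "1 = sum t (support t)"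
    using t by (simp add: mem_realization)
  also have "\<dots> = sum t W"
    using sum_support[OF W] t by (simp add: mem_realization)
  finally show False by simp
qed

lemma continuous_map_powertop_coordinate: "continuous_map (powertop_real UNIV) euclideanreal (\<lambda>t. t v)"
  using continuous_map_product_projection[of v UNIV "\<lambda>_. euclideanreal"] by simp

lemma closedin_closed_simplex:
  fixes \<sigma> :: "'v set"
  assumes "finite \<sigma>"
  shows "closedin (powertop_real UNIV) (closed_simplex \<sigma>)"
proof -
  note p = continuous_map_powertop_coordinate
  have "closedin (powertop_real UNIV) {t \<in> topspace (powertop_real UNIV). t v \<in> {0..}}" for v :: 'v
    by (rule closedin_continuous_map_preimage[OF p]) simp
  then have 1: "closedin (powertop_real UNIV) (\<Inter>v. {t. 0 \<le> t v} :: ('v \<Rightarrow> real) set)"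
    by (intro closedin_INT) auto
  have "closedin (powertop_real UNIV) {t \<in> topspace (powertop_real UNIV). t v \<in> (if v \<in> \<sigma> then UNIV else {0})}" for v
    by (rule closedin_continuous_map_preimage[OF p]) auto
  then have 2: "closedin (powertop_real UNIV) (\<Inter>v. {t. t v \<in> (if v \<in> \<sigma> then UNIV else {0})})"
    by (intro closedin_INT) auto
  have "continuous_map (powertop_real UNIV) euclideanreal (\<lambda>t. sum t \<sigma>)"
    using assms by (intro continuous_map_sum p)
  from closedin_continuous_map_preimage[OF this, of "{1}"]
  have 3: "closedin (powertop_real UNIV) {t. sum t \<sigma> = 1}"
    by simp
  have "closed_simplex \<sigma> = (\<Inter>v. {t. 0 \<le> t v}) \<inter> (\<Inter>v. {t. t v \<in> (if v \<in> \<sigma> then UNIV else {0})}) \<inter> {t. sum t \<sigma> = 1}"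
    by (auto simp: closed_simplex_def split: if_splits)
  then show ?thesis
    using closedin_Int[OF closedin_Int[OF 1 2] 3] by simp
qed

lemma closedin_realization:
  "closedin (geometric_realization K) C \<longleftrightarrow>
     C \<subseteq> topspace (geometric_realization K) \<and> (\<forall>\<sigma>\<in>K. closedin (powertop_real UNIV) (C \<inter> closed_simplex \<sigma>))"
proof -
  have "closedin (powertop_real UNIV) (C \<inter> closed_simplex \<sigma>) \<longleftrightarrow>
      openin (subtopology (powertop_real UNIV) (closed_simplex \<sigma>))
         ((topspace (geometric_realization K) - C) \<inter> closed_simplex \<sigma>)" if "\<sigma> \<in> K" for \<sigma>
  proof -
    have "closed_simplex \<sigma> \<subseteq> topspace (geometric_realization K)"
      using that by (auto simp: topspace_geometric_realization)
    then have "(topspace (geometric_realization K) - C) \<inter> closed_simplex \<sigma> = closed_simplex \<sigma> - C \<inter> closed_simplex \<sigma>"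
      by blast
    moreover have "closedin (powertop_real UNIV) (C \<inter> closed_simplex \<sigma>) \<longleftrightarrow>
       closedin (subtopology (powertop_real UNIV) (closed_simplex \<sigma>)) (C \<inter> closed_simplex \<sigma>)"
      using closedin_closed_simplex[OF finite_simplex[OF that]] closedin_closed_subtopology by fastforce
    ultimately show ?thesis
      by (simp add: closedin_def)
  qed
  then show ?thesis
    by (auto simp: closedin_def[of "geometric_realization K"] openin_geometric_realization topspace_geometric_realization)
qed

lemma continuous_map_coordinate:
  "continuous_map (geometric_realization K) euclideanreal (\<lambda>t. t v)"
proof (clarsimp simp: continuous_map_closedin)
  fix C :: "real set" assume C: "closed C"
  let ?D = "{t \<in> topspace (geometric_realization K). t v \<in> C}"
  have "closedin (powertop_real UNIV) {t \<in> topspace (powertop_real UNIV). t v \<in> C}"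
    using C by (intro closedin_continuous_map_preimage[OF continuous_map_powertop_coordinate]) simp
  moreover have "?D \<inter> closed_simplex \<sigma> = {t \<in> topspace (powertop_real UNIV). t v \<in> C} \<inter> closed_simplex \<sigma>"
    if "\<sigma> \<in> K" for \<sigma>
    using that by (auto simp: topspace_geometric_realization)
  ultimately show "closedin (geometric_realization K) ?D"
    by (auto simp: closedin_realization finite_simplex intro!: closedin_Int closedin_closed_simplex)
qed

text \<open>Otherwise choose, for each vertex \<open>v\<close> that occurs, a point of the image with \<open>v\<close> in its support.
  These points form an infinite set that meets every closed simplex in a finite set, so all
  its subsets are closed: an infinite closed discrete subset of a compact image.\<close>

lemma finite_support_of_compact:
  assumes X: "compact_space X" and f: "continuous_map X (geometric_realization K) f"
  shows "\<exists>W. finite W \<and> (\<forall>x\<in>topspace X. support (f x) \<subseteq> W)"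
proof -
  let ?Y = "geometric_realization K"
  define U where "U = (\<Union>x\<in>topspace X. support (f x))"
  have fY: "f x \<in> topspace ?Y" if "x \<in> topspace X" for x
    using f that by (auto simp: continuous_map_def)
  have "\<exists>x\<in>topspace X. v \<in> support (f x)" if "v \<in> U" for v
    using that by (auto simp: U_def)
  then obtain p where p: "\<And>v. v \<in> U \<Longrightarrow> p v \<in> topspace X \<and> v \<in> support (f (p v))"
    by metis
  define D where "D = (\<lambda>v. f (p v)) ` U"
  have closed: "closedin ?Y E" if "E \<subseteq> D" for E
  proof -
    have "finite (E \<inter> closed_simplex \<sigma>)" if "\<sigma> \<in> K" for \<sigma>
    proof (rule finite_subset)
      show "E \<inter> closed_simplex \<sigma> \<subseteq> (\<lambda>v. f (p v)) ` \<sigma>"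
      proof
        fix t assume t: "t \<in> E \<inter> closed_simplex \<sigma>"
        then obtain v where v: "v \<in> U" "t = f (p v)" using \<open>E \<subseteq> D\<close> by (auto simp: D_def)
        then have "t v \<noteq> 0" using p[OF v(1)] by simp
        then have "v \<in> \<sigma>" using t by (auto simp: closed_simplex_def)
        then show "t \<in> (\<lambda>v. f (p v)) ` \<sigma>" using v(2) by (rule rev_image_eqI)
      qed
    qed (use finite_simplex that in auto)
    then have "closedin (powertop_real UNIV) (E \<inter> closed_simplex \<sigma>)" if "\<sigma> \<in> K" for \<sigma>
      using that t1_space_product_topology[of "\<lambda>_. euclideanreal" "UNIV :: 'v set"] t1_space_euclidean
      by (auto simp: t1_space_closedin_finite)
    moreover have "E \<subseteq> topspace ?Y"
      using \<open>E \<subseteq> D\<close> p fY by (auto simp: D_def)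
    ultimately show ?thesis
      by (simp add: closedin_realization)
  qed
  define N where "N d = {x \<in> topspace X. f x \<in> topspace ?Y - (D - {d})}" for d
  have "finite D"
  proof (cases "D = {}")
    case False
    have "openin X (N d)" for d
      unfolding N_def by (rule openin_continuous_map_preimage[OF f openin_diff[OF openin_topspace closed]]) blast
    moreover have "topspace X \<subseteq> \<Union>(N ` D)"
    proof
      fix x assume x: "x \<in> topspace X"
      obtain d where "d \<in> D" "f x \<notin> D - {d}"
        using False by blast
      then show "x \<in> \<Union>(N ` D)"
        using x fY[OF x] unfolding N_def by blast
    qed
    ultimately obtain \<F> where F: "finite \<F>" "\<F> \<subseteq> N ` D" "topspace X \<subseteq> \<Union>\<F>"
      using compactinD[of X "topspace X" "N ` D"] X unfolding compact_space_def by blast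
    obtain E where E: "finite E" "E \<subseteq> D" "\<F> = N ` E"
      using finite_subset_image[OF F(1,2)] by blast
    have "D \<subseteq> E"
    proof
      fix d assume d: "d \<in> D"
      then obtain x where x: "x \<in> topspace X" "d = f x" using p by (auto simp: D_def)
      then obtain e where "e \<in> E" "f x \<notin> D - {e}" using F(3) unfolding E(3) N_def by blast
      then show "d \<in> E" using x d by auto
    qed
    then show ?thesis using E(1) finite_subset by blast
  qed auto
  moreover have "finite (support t)" if "t \<in> D" for t
    using that p fY finite_simplex by (auto simp: D_def mem_realization)
  ultimately have "finite (\<Union>t\<in>D. support t)" by blast
  moreover have "U \<subseteq> (\<Union>t\<in>D. support t)" using p by (auto simp: D_def)
  ultimately show ?thesis
    using finite_subset U_def by blast
qed

lemma continuous_map_imp_weight_map: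
  assumes "compact_space X" "continuous_map X (geometric_realization K) f"
  shows "weight_map X K f"
proof -
  have "f x \<in> topspace (geometric_realization K)" if "x \<in> topspace X" for x
    using assms(2) that by (auto simp: continuous_map_def)
  moreover have "continuous_map X euclideanreal (\<lambda>x. f x v)" for v
    using continuous_map_compose[OF assms(2) continuous_map_coordinate] by (simp add: o_def)
  ultimately show ?thesis
    using finite_support_of_compact[OF assms] by (auto simp: weight_map_def mem_realization)
qed

text \<open>All values lie in the finitely many closed simplices spanned by vertices in \<open>W\<close>, so the
  preimage of a closed set is a finite union of preimages of sets closed in the product topology.\<close>

lemma weight_map_imp_continuous_map:
  assumes g: "weight_map X K g"
  shows "continuous_map X (geometric_realization K) (\<lambda>x. barycentric (g x))"
proof -
  let ?f = "\<lambda>x. barycentric (g x)" and ?Y = "geometric_realization K"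
  obtain W where W: "finite W" "\<And>x. x \<in> topspace X \<Longrightarrow> support (g x) \<subseteq> W"
    using g by (auto simp: weight_map_def)
  have K: "support (g x) \<in> K" and nn: "\<And>v. 0 \<le> g x v" if "x \<in> topspace X" for x
    using g that by (auto simp: weight_map_def)
  have s: "sum (g x) (support (g x)) = sum (g x) W" if "x \<in> topspace X" for x
    using sum_support[OF W] nn that by blast
  have fY: "?f x \<in> topspace ?Y" if x: "x \<in> topspace X" for x
    using K[OF x] nn[OF x] sum_support_pos[OF K[OF x]]
    by (simp add: mem_realization) (simp add: barycentric_def flip: sum_divide_distrib)
  have gc: "continuous_map X euclideanreal (\<lambda>x. g x v)" for v
    using g by (simp add: weight_map_def)
  have "continuous_map X euclideanreal (\<lambda>x. ?f x v)" for v
  proof -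
    have "continuous_map X euclideanreal (\<lambda>x. g x v / sum (g x) W)"
    proof (intro continuous_map_real_divide continuous_map_sum W(1) gc)
      show "sum (g x) W \<noteq> 0" if "x \<in> topspace X" for x
        using sum_support_pos[OF K[OF that]] s[OF that] by simp
    qed
    then show ?thesis
      by (rule continuous_map_eq) (simp add: barycentric_def s)
  qed
  then have cont: "continuous_map X (powertop_real UNIV) ?f"
    by (simp add: continuous_map_componentwise_UNIV)
  show ?thesis
    unfolding continuous_map_closedin
  proof (intro conjI ballI allI impI)
    show "?f \<in> topspace X \<rightarrow> topspace ?Y" using fY by auto
    fix C assume C: "closedin ?Y C"
    have "{x \<in> topspace X. ?f x \<in> C}
        = (\<Union>\<sigma>\<in>{\<sigma> \<in> K. \<sigma> \<subseteq> W}. {x \<in> topspace X. ?f x \<in> C \<inter> closed_simplex \<sigma>})"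
    proof (intro equalityI subsetI)
      fix x assume x: "x \<in> {x \<in> topspace X. ?f x \<in> C}"
      then have "?f x \<in> closed_simplex (support (g x))"
        using fY[of x] K[of x] finite_simplex by (subst mem_closed_simplex_iff) auto
      then show "x \<in> (\<Union>\<sigma>\<in>{\<sigma> \<in> K. \<sigma> \<subseteq> W}. {x \<in> topspace X. ?f x \<in> C \<inter> closed_simplex \<sigma>})"
        using x K[of x] W(2)[of x] by blast
    qed auto
    moreover have "closedin X {x \<in> topspace X. ?f x \<in> C \<inter> closed_simplex \<sigma>}" if "\<sigma> \<in> K" for \<sigma>
      using C that by (intro closedin_continuous_map_preimage[OF cont]) (simp add: closedin_realization)
    moreover have "finite {\<sigma> \<in> K. \<sigma> \<subseteq> W}"
      using W(1) by (simp add: finite_subset[of _ "Pow W"] subset_iff)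
    ultimately show "closedin X {x \<in> topspace X. ?f x \<in> C}"
      by (auto intro!: closedin_Union)
  qed
qed

lemma weight_map_barycentric:
  assumes "continuous_map X (geometric_realization K) f" "x \<in> topspace X"
  shows "barycentric (f x) = f x"
  using assms by (intro barycentric_id) (auto simp: continuous_map_def mem_realization Pi_iff)

end

section \<open>Homotopies of maps from spheres\<close>

abbreviation Sph :: "nat \<Rightarrow> (nat \<Rightarrow> real) set" where
  "Sph i \<equiv> topspace (nsphere i)"

lemma Sph_iff: "x \<in> Sph i \<longleftrightarrow> L2_set x {..i} = 1 \<and> (\<forall>j>i. x j = 0)"
  by (simp add: nsphere L2_set_def)

lemma nsphere_eq_top_of_set: "nsphere i = top_of_set (Sph i)"
  by (simp add: nsphere euclidean_product_topology)

lemma continuous_map_nsphere_iff: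
  "continuous_map (nsphere i) euclidean h \<longleftrightarrow> continuous_on (Sph i) h"
  by (metis continuous_map_iff_continuous nsphere_eq_top_of_set)

lemma prod_nsphere_eq_top_of_set:
  "prod_topology (top_of_set T) (nsphere i) = top_of_set (T \<times> Sph i)"
  by (metis nsphere_eq_top_of_set prod_topology_subtopology_eu)

lemma compact_Sph: "compact (Sph i)"
proof -
  have "compactin (powertop_real UNIV) (PiE UNIV (\<lambda>j. if j \<le> i then {-1..1} else {0}))"
    by (auto simp: compactin_PiE)
  then have "compact (PiE UNIV (\<lambda>j. if j \<le> i then {-1..1} else {0::real}))"
    by (simp add: euclidean_product_topology)
  moreover have "closed {x::nat \<Rightarrow> real. (\<Sum>j\<le>i. (x j)\<^sup>2) = 1}"
    by (intro closed_Collect_eq continuous_intros continuous_on_product_coordinates)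
  ultimately have "compact (PiE UNIV (\<lambda>j. if j \<le> i then {-1..1} else {0::real}) \<inter> {x. (\<Sum>j\<le>i. (x j)\<^sup>2) = 1})"
    by (rule compact_Int_closed)
  moreover have "Sph i = PiE UNIV (\<lambda>j. if j \<le> i then {-1..1} else {0::real}) \<inter> {x. (\<Sum>j\<le>i. (x j)\<^sup>2) = 1}"
  proof -
    have "\<bar>x j\<bar> \<le> 1" if "(\<Sum>j\<le>i. (x j)\<^sup>2) = 1" "j \<le> i" for x :: "nat \<Rightarrow> real" and j
    proof -
      have "(x j)\<^sup>2 \<le> (\<Sum>j\<le>i. (x j)\<^sup>2)"
        using that(2) by (intro member_le_sum) auto
      then show ?thesis using that(1) by (simp add: abs_square_le_1)
    qed
    then show ?thesis
      by (auto simp: nsphere PiE_iff abs_le_iff minus_le_iff split: if_splits)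
  qed
  ultimately show ?thesis by simp
qed

lemma compact_space_nsphere: "compact_space (nsphere i)"
  using compact_Sph[of i] by (subst nsphere_eq_top_of_set) (simp add: compact_space_subtopology)

lemma compact_space_cylinder: "compact_space (prod_topology (top_of_set {0..1::real}) (nsphere i))"
  by (simp add: compact_space_prod_topology compact_space_nsphere compact_space_subtopology)

text \<open>Polar coordinates on the unit ball of dimension \<open>i + 1\<close>, as the quotient of a cylinder over the
  \<open>i\<close>-sphere: height 0 is the boundary sphere, and the whole ball of radius \<open>1/2\<close> is sent to height 1.
  A function on the cylinder that is constant at height 1 thus becomes constant near the centre, where the
  direction is undefined. Only the coordinates up to \<open>i\<close> of the argument matter, so a hemisphere
  of the \<open>(i + 1)\<close>-sphere may be used in place of the ball.\<close>

definition cone_coord :: "nat \<Rightarrow> (nat \<Rightarrow> real) \<Rightarrow> real \<times> (nat \<Rightarrow> real)" where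
  "cone_coord i z =
     (if L2_set z {..i} \<le> 1/2 then (1, nsphere_base)
      else (2 * (1 - L2_set z {..i}), \<lambda>j. if j \<le> i then z j / L2_set z {..i} else 0))"

lemma sum_squares_normalized:
  assumes "L2_set z A \<noteq> 0"
  shows "(\<Sum>j\<in>A. (z j / L2_set z A)\<^sup>2) = 1"
proof -
  have "(L2_set z A)\<^sup>2 = (\<Sum>j\<in>A. (z j)\<^sup>2)"
    by (simp add: L2_set_def sum_nonneg)
  moreover have "(\<Sum>j\<in>A. (z j / L2_set z A)\<^sup>2) = (\<Sum>j\<in>A. (z j)\<^sup>2) / (L2_set z A)\<^sup>2"
    by (simp add: power_divide sum_divide_distrib)
  ultimately have "(\<Sum>j\<in>A. (z j / L2_set z A)\<^sup>2) = (L2_set z A)\<^sup>2 / (L2_set z A)\<^sup>2"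
    by (simp only:)
  then show ?thesis using assms by simp
qed

lemma cone_coord_mem:
  assumes "L2_set z {..i} \<le> 1"
  shows "cone_coord i z \<in> {0..1} \<times> Sph i"
proof (cases "L2_set z {..i} \<le> 1/2")
  case True
  then show ?thesis
    using nsphere_base_in_nsphere by (simp add: cone_coord_def)
next
  case False
  then show ?thesis
    using sum_squares_normalized[of z "{..i}"] assms by (simp add: cone_coord_def nsphere)
qed

lemma cone_coord_sphere: "z \<in> Sph i \<Longrightarrow> cone_coord i z = (0, z)"
  by (auto simp: Sph_iff cone_coord_def fun_eq_iff)

lemma continuous_on_L2_set: "continuous_on S (\<lambda>z::nat \<Rightarrow> real. L2_set z {..i})"
  unfolding L2_set_def by (intro continuous_intros continuous_on_subset[OF continuous_on_product_coordinates]) auto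

lemma continuous_on_cone_coord:
  fixes P :: "real \<times> (nat \<Rightarrow> real) \<Rightarrow> 'b::topological_space"
  assumes P: "continuous_on ({0..1} \<times> Sph i) P"
    and const: "\<And>x. x \<in> Sph i \<Longrightarrow> P (1, x) = P (1, nsphere_base)"
  shows "continuous_on {z. L2_set z {..i} \<le> 1} (\<lambda>z. P (cone_coord i z))"
proof -
  let ?D = "{z. L2_set z {..i} \<le> 1}" and ?r = "\<lambda>z. L2_set z {..i}"
  let ?c = "\<lambda>z. (2 * (1 - ?r z), \<lambda>j. if j \<le> i then z j / ?r z else 0)"
  have mem: "?c z \<in> {0..1} \<times> Sph i" if "?r z \<le> 1" "1/2 \<le> ?r z" for z
  proof (cases "?r z = 1/2")
    case True
    then show ?thesis
      using sum_squares_normalized[of z "{..i}"] by (simp add: nsphere)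
  next
    case False
    then show ?thesis using cone_coord_mem[OF that(1)] that by (simp add: cone_coord_def)
  qed
  have c: "continuous_on {z \<in> ?D. 1/2 \<le> ?r z} ?c"
  proof (intro continuous_on_Pair)
    show "continuous_on {z \<in> ?D. 1/2 \<le> ?r z} (\<lambda>z j. if j \<le> i then z j / ?r z else 0)"
    proof (intro continuous_on_coordinatewise_then_product)
      show "continuous_on {z \<in> ?D. 1/2 \<le> ?r z} (\<lambda>z. if j \<le> i then z j / ?r z else 0)" for j
        by (cases "j \<le> i")
          (auto intro!: continuous_on_divide continuous_on_L2_set
            continuous_on_subset[OF continuous_on_product_coordinates])
    qed
  qed (intro continuous_intros continuous_on_L2_set)
  have "continuous_on {z \<in> ?D. 1/2 \<le> ?r z} (\<lambda>z. P (?c z))"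
    using mem by (intro continuous_on_compose2[OF P c]) auto
  then have "continuous_on ?D (\<lambda>z. if ?r z \<le> 1/2 then P (1, nsphere_base) else P (?c z))"
  proof (rule continuous_on_cases_le[rotated])
    fix z assume z: "z \<in> ?D" "?r z = 1/2"
    then have "snd (?c z) \<in> Sph i" and r: "2 * (1 - ?r z) = 1"
      using mem[of z] by auto
    then have "P (1, snd (?c z)) = P (1, nsphere_base)"
      by (intro const)
    then show "P (1, nsphere_base) = P (?c z)"
      unfolding r by simp
  qed (intro continuous_on_const continuous_on_L2_set)+
  then show ?thesis
    by (rule continuous_on_eq) (auto simp: cone_coord_def)
qed

lemma trivial_homotopy_groupI:
  assumes "\<And>y f. \<lbrakk>y \<in> topspace Y; f \<in> based_maps i Y y\<rbrakk> \<Longrightarrow> homotopic_with (\<lambda>h. h nsphere_base = y) (nsphere i) Y f (\<lambda>_. y)"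
  shows "trivial_homotopy_group i Y"
  unfolding trivial_homotopy_group_def homotopy_group_carrier_def
proof
  fix y assume y: "y \<in> topspace Y"
  let ?R = "{(f, g). homotopic_with (\<lambda>h. h nsphere_base = y) (nsphere i) Y f g}"
  have c: "(\<lambda>_. y) \<in> based_maps i Y y"
    using y by (simp add: based_maps_def)
  have "based_maps i Y y // ?R = {?R `` {\<lambda>_. y}}"
  proof (intro equalityI subsetI)
    fix A assume "A \<in> based_maps i Y y // ?R"
    then obtain f where f: "f \<in> based_maps i Y y" "A = ?R `` {f}"
      by (auto elim: quotientE)
    then have "(f, \<lambda>_. y) \<in> ?R" using assms[OF y] by simp
    then show "A \<in> {?R `` {\<lambda>_. y}}"
      using equiv_class_eq[OF equiv_based_homotopy] f(2) by simp
  next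
    fix A assume "A \<in> {?R `` {\<lambda>_. y}}"
    then show "A \<in> based_maps i Y y // ?R"
      using quotientI[OF c] by (simp only: singleton_iff)
  qed
  then show "is_singleton (based_maps i Y y // ?R)" by simp
qed

lemma trivial_homotopy_groupD:
  assumes "trivial_homotopy_group i Y" and f: "continuous_map (nsphere i) Y f"
  shows "homotopic_with (\<lambda>_. True) (nsphere i) Y f (\<lambda>_. f nsphere_base)"
proof -
  let ?y = "f nsphere_base"
  let ?R = "{(f, g). homotopic_with (\<lambda>h. h nsphere_base = ?y) (nsphere i) Y f g}"
  have y: "?y \<in> topspace Y"
    using f nsphere_base_in_nsphere by (auto simp: continuous_map_def)
  then obtain A where "based_maps i Y ?y // ?R = {A}"
    using assms(1) unfolding trivial_homotopy_group_def homotopy_group_carrier_def by (metis is_singleton_def)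
  moreover have fc: "f \<in> based_maps i Y ?y" "(\<lambda>_. ?y) \<in> based_maps i Y ?y"
    using f y by (auto simp: based_maps_def)
  ultimately have "?R `` {f} = ?R `` {\<lambda>_. ?y}"
    by (metis quotientI singletonD)
  then have "(f, \<lambda>_. ?y) \<in> ?R"
    using eq_equiv_class_iff[OF equiv_based_homotopy fc] by simp
  then show ?thesis
    by (auto elim: homotopic_with_mono)
qed

context abstract_complex
begin

text \<open>A free null-homotopy extends \<open>f\<close> to the ball; contracting the ball linearly to the base point
  then moves \<open>f\<close> to a constant map while the base point stays fixed.\<close>

lemma based_nullhomotopy:
  assumes f: "f \<in> based_maps i (geometric_realization K) y"
    and H: "homotopic_with (\<lambda>_. True) (nsphere i) (geometric_realization K) f (\<lambda>_. c)"
  shows "homotopic_with (\<lambda>h. h nsphere_base = y) (nsphere i) (geometric_realization K) f (\<lambda>_. y)"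
proof -
  let ?Y = "geometric_realization K"
  obtain H where H: "continuous_map (prod_topology (top_of_set {0..1::real}) (nsphere i)) ?Y H"
      "\<And>x. H (0, x) = f x" "\<And>x. H (1, x) = c"
    using H unfolding homotopic_with_def by blast
  define C where "C = {0..1::real} \<times> Sph i"
  have HY: "H p \<in> topspace ?Y" if "p \<in> C" for p
    using H(1) that by (auto simp: C_def continuous_map_def Pi_iff)
  have w: "weight_map (top_of_set C) K H"
    using continuous_map_imp_weight_map[OF compact_space_cylinder H(1)] by (simp add: C_def prod_nsphere_eq_top_of_set)
  define m where "m = (\<lambda>p::real \<times> (nat \<Rightarrow> real). \<lambda>j. (1 - fst p) * snd p j + fst p * nsphere_base j)"
  have m_le: "L2_set (m p) {..i} \<le> 1" if pC: "p \<in> C" for p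
  proof -
    obtain t x where p: "p = (t, x)" "0 \<le> t" "t \<le> 1" "x \<in> Sph i" using pC by (cases p) (auto simp: C_def)
    have "L2_set (m p) {..i} \<le> L2_set (\<lambda>j. (1 - t) * x j) {..i} + L2_set (\<lambda>j. t * nsphere_base j) {..i}"
      unfolding m_def p by (simp add: L2_set_triangle_ineq)
    also have "\<dots> = (1 - t) * L2_set x {..i} + t * L2_set nsphere_base {..i}"
      using p by (simp add: L2_set_right_distrib)
    also have "\<dots> = 1"
      using p(4) nsphere_base_in_nsphere[of i] by (simp add: Sph_iff)
    finally show ?thesis .
  qed
  have cm: "cone_coord i (m p) \<in> C" if "p \<in> C" for p
    using cone_coord_mem[OF m_le[OF that]] by (simp add: C_def)
  define B where "B = (\<lambda>p. H (cone_coord i (m p)))"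
  have m_cont: "continuous_on C m"
    unfolding m_def
  proof (rule continuous_on_coordinatewise_then_product)
    fix j
    have "continuous_on C (\<lambda>p. snd p j)"
      by (rule continuous_on_compose2[OF continuous_on_product_coordinates[of j] continuous_on_snd[OF continuous_on_id]]) simp
    then show "continuous_on C (\<lambda>p. (1 - fst p) * snd p j + fst p * nsphere_base j)"
      by (intro continuous_on_add continuous_on_mult continuous_on_diff continuous_on_const continuous_on_fst continuous_on_id)
  qed
  have "weight_map (top_of_set C) K B"
    unfolding weight_map_def
  proof (intro conjI allI)
    show "\<exists>W. finite W \<and> (\<forall>p\<in>topspace (top_of_set C). support (B p) \<subseteq> W)"
    proof -
      obtain W where "finite W" "\<forall>p\<in>C. support (H p) \<subseteq> W"
        using w by (auto simp: weight_map_def)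
      then show ?thesis
        using cm by (intro exI[of _ W]) (simp add: B_def)
    qed
    show "\<forall>p\<in>topspace (top_of_set C). (\<forall>v. 0 \<le> B p v) \<and> support (B p) \<in> K"
      using w cm unfolding weight_map_def B_def by simp
    fix v
    have "continuous_on C (\<lambda>p. H p v)"
      using w by (simp add: weight_map_def)
    then have "continuous_on {z. L2_set z {..i} \<le> 1} (\<lambda>z. H (cone_coord i z) v)"
      unfolding C_def by (rule continuous_on_cone_coord) (simp add: H(3))
    then have "continuous_on C (\<lambda>p. B p v)"
      unfolding B_def by (rule continuous_on_compose2[OF _ m_cont]) (auto simp: m_le)
    then show "continuous_map (top_of_set C) euclideanreal (\<lambda>p. B p v)"
      by simp
  qed
  then have "continuous_map (top_of_set C) ?Y (\<lambda>p. barycentric (B p))"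
    by (rule weight_map_imp_continuous_map)
  moreover have "barycentric (B p) = B p" if "p \<in> C" for p
    using HY[OF cm[OF that]] by (simp add: B_def mem_realization barycentric_id)
  ultimately have "continuous_map (prod_topology (top_of_set {0..1}) (nsphere i)) ?Y B"
    unfolding prod_nsphere_eq_top_of_set C_def[symmetric] by (rule continuous_map_eq) simp
  moreover have "B (0, x) = f x" if "x \<in> Sph i" for x
    using that H(2) by (simp add: B_def m_def cone_coord_sphere)
  moreover have "m (t, nsphere_base) = nsphere_base" "m (1, x) = nsphere_base" for t x
    by (simp_all add: m_def algebra_simps)
  then have "B (t, nsphere_base) = y" "B (1, x) = y" for t x
    using f H(2) nsphere_base_in_nsphere[of i] by (simp_all add: B_def cone_coord_sphere based_maps_def)
  ultimately have "continuous_map (prod_topology (top_of_set {0..1}) (nsphere i)) ?Y B \<and>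
      (\<forall>x\<in>Sph i. B (0, x) = f x) \<and> (\<forall>x\<in>Sph i. B (1, x) = y) \<and> (\<forall>t\<in>{0..1}. B (t, nsphere_base) = y)"
    by blast
  then show ?thesis
    using nsphere_base_in_nsphere[of i] by (subst homotopic_with) (metis, rule exI)
qed

end

section \<open>Low-dimensional approximation of spheres in a complex\<close>

text \<open>A continuous function of \<open>q\<close> that is positive exactly on the open star of the grid point \<open>p\<close> in the
  Kuhn (Freudenthal) triangulation of the integer grid: there all differences of coordinates of \<open>q - p\<close>
  are less than 1. The extra index \<open>Suc i\<close>, at which \<open>q\<close> and \<open>p\<close> vanish, includes the comparison
  with 0.\<close>

definition kuhn_hat :: "nat \<Rightarrow> (nat \<Rightarrow> int) \<Rightarrow> (nat \<Rightarrow> real) \<Rightarrow> real" where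
  "kuhn_hat i p q = (\<Prod>a\<le>Suc i. \<Prod>b\<le>Suc i. max 0 (1 - ((q a - p a) - (q b - p b))))"

lemma kuhn_hat_nonneg: "0 \<le> kuhn_hat i p q"
  by (simp add: kuhn_hat_def prod_nonneg)

lemma kuhn_hat_pos_iff:
  "0 < kuhn_hat i p q \<longleftrightarrow> (\<forall>a\<le>Suc i. \<forall>b\<le>Suc i. (q a - p a) - (q b - p b) < 1)"
proof -
  have "0 < kuhn_hat i p q \<longleftrightarrow> kuhn_hat i p q \<noteq> 0"
    using kuhn_hat_nonneg[of i p q] by linarith
  also have "\<dots> \<longleftrightarrow> (\<forall>a\<le>Suc i. \<forall>b\<le>Suc i. max 0 (1 - ((q a - p a) - (q b - p b))) \<noteq> 0)"
    unfolding kuhn_hat_def by (subst prod_zero_iff, simp, subst prod_zero_iff) (auto simp del: prod.atMost_Suc)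
  also have "\<dots> \<longleftrightarrow> (\<forall>a\<le>Suc i. \<forall>b\<le>Suc i. (q a - p a) - (q b - p b) < 1)"
  proof -
    have "max 0 (1 - t) \<noteq> 0 \<longleftrightarrow> t < 1" for t :: real by linarith
    then show ?thesis by simp
  qed
  finally show ?thesis .
qed

lemma kuhn_hat_floor: "0 < kuhn_hat i (\<lambda>j. \<lfloor>q j\<rfloor>) q"
proof -
  have "(q a - \<lfloor>q a\<rfloor>) - (q b - \<lfloor>q b\<rfloor>) < 1" for a b
    by linarith
  then show ?thesis by (simp add: kuhn_hat_pos_iff)
qed

lemma kuhn_hat_close:
  assumes "0 < kuhn_hat i p q" "q (Suc i) = 0" "p (Suc i) = 0" "j \<le> i"
  shows "\<bar>q j - p j\<bar> < 1"
proof -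
  have "(q j - p j) - (q (Suc i) - p (Suc i)) < 1" "(q (Suc i) - p (Suc i)) - (q j - p j) < 1"
    using assms(1,4) unfolding kuhn_hat_pos_iff by auto
  then show ?thesis using assms by simp
qed

text \<open>The grid points whose star contains \<open>q\<close> are rounded versions of \<open>q\<close>, up or down in each
  coordinate. Any two of them are comparable coordinatewise, so they form a chain and are told apart by
  the number of coordinates rounded up; an integral coordinate is never rounded.\<close>

lemma card_kuhn_hat_pos:
  assumes q: "\<And>j. i < j \<Longrightarrow> q j = 0" and j0: "j0 \<le> i" "q j0 \<in> \<int>"
  defines "A \<equiv> {p. (\<forall>j>i. p j = 0) \<and> 0 < kuhn_hat i p q}"
  shows "finite A \<and> card A \<le> Suc i"
proof -
  define s where "s = (\<lambda>p. nat (\<Sum>j\<le>i. p j - \<lfloor>q j\<rfloor>))"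
  have digit: "p j - \<lfloor>q j\<rfloor> \<in> {0..1}" if "p \<in> A" "j \<le> i" for p j
  proof -
    have "\<bar>q j - p j\<bar> < 1"
      using that q by (intro kuhn_hat_close[of i]) (auto simp: A_def)
    then have "\<lfloor>q j\<rfloor> - 1 < p j" "p j < \<lfloor>q j\<rfloor> + 2"
      by linarith+
    then show ?thesis by simp
  qed
  have digit0: "p j0 - \<lfloor>q j0\<rfloor> = 0" if "p \<in> A" for p
  proof -
    obtain m where m: "q j0 = of_int m" using j0(2) by (auto elim: Ints_cases)
    have "\<bar>q j0 - p j0\<bar> < 1"
      using that q j0 by (intro kuhn_hat_close[of i]) (auto simp: A_def)
    then have "m = p j0" using m by linarith
    then show ?thesis using m by simp
  qed
  have "s p \<le> i" if "p \<in> A" for p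
  proof -
    have "(\<Sum>j\<le>i. p j - \<lfloor>q j\<rfloor>) = (\<Sum>j\<in>{..i} - {j0}. p j - \<lfloor>q j\<rfloor>)"
      using digit0[OF that] j0(1) by (intro sum.mono_neutral_right) auto
    also have "\<dots> \<le> of_nat (card ({..i} - {j0})) * 1"
      using digit[OF that] by (intro sum_bounded_above) auto
    finally show ?thesis using j0(1) by (simp add: s_def)
  qed
  then have sub: "s ` A \<subseteq> {..i}" by auto
  have le: "p = p'" if p: "p \<in> A" "p' \<in> A" "s p = s p'" and less: "\<And>j. j \<le> i \<Longrightarrow> p j \<le> p' j" for p p'
  proof
    fix j
    have nonneg: "0 \<le> (\<Sum>j\<le>i. r j - \<lfloor>q j\<rfloor>)" if "r \<in> A" for r
      using digit[OF that] by (intro sum_nonneg) auto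
    have "(\<Sum>j\<le>i. p j - \<lfloor>q j\<rfloor>) = (\<Sum>j\<le>i. p' j - \<lfloor>q j\<rfloor>)"
      using p(3) nonneg[OF p(1)] nonneg[OF p(2)] by (simp add: s_def)
    then have "(\<Sum>j\<le>i. p' j - p j) = 0"
      by (simp add: sum_subtractf)
    moreover have "0 \<le> p' j - p j" if "j \<le> i" for j
      using less[OF that] by simp
    ultimately have "p' j - p j = 0" if "j \<le> i" for j
      using that sum_nonneg_eq_0_iff[of "{..i}" "\<lambda>j. p' j - p j"] by simp
    then show "p j = p' j"
      using p(1,2) by (cases "j \<le> i") (auto simp: A_def)
  qed
  \<comment> \<open>if \<open>p\<close> is larger at \<open>a\<close> and \<open>p'\<close> at \<open>b\<close>, adding both star inequalities contradicts integrality\<close>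
  have chain: "(\<forall>j\<le>i. p j \<le> p' j) \<or> (\<forall>j\<le>i. p' j \<le> p j)" if p: "p \<in> A" "p' \<in> A" for p p'
  proof (rule ccontr)
    assume "\<not> ?thesis"
    then obtain a b where ab: "a \<le> i" "b \<le> i" "p' a < p a" "p b < p' b" by (auto simp: not_le)
    have "(q b - p b) - (q a - p a) < 1" "(q a - p' a) - (q b - p' b) < 1"
      using p ab by (auto simp: A_def kuhn_hat_pos_iff)
    then have "(p' b - p b) + (p a - p' a) < 2" by linarith
    then show False using ab by linarith
  qed
  have "inj_on s A"
  proof (rule inj_onI)
    fix p p' assume "p \<in> A" "p' \<in> A" "s p = s p'"
    then show "p = p'" using chain[of p p'] le[of p p'] le[of p' p] by auto
  qed
  then show ?thesis
    using sub card_inj_on_le[of s A "{..i}"] inj_on_finite[of s A "{..i}"] by simp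
qed

lemma dist_fun_le:
  fixes x y :: "nat \<Rightarrow> real"
  assumes "\<And>j. \<bar>x j - y j\<bar> \<le> e"
  shows "dist x y \<le> 2 * e"
proof -
  have s: "summable (\<lambda>n. (1/2) ^ n * e)"
    by (intro summable_mult2 summable_geometric) simp
  have e: "0 \<le> e" using assms[of 0] by linarith
  have "dist x y = suminf (\<lambda>n. (1/2) ^ n * min (dist (x (from_nat n)) (y (from_nat n))) 1)"
    by (simp add: dist_fun_def)
  also have "\<dots> \<le> suminf (\<lambda>n. (1/2) ^ n * e)"
  proof (rule suminf_le[OF _ _ s])
    show le: "(1/2) ^ n * min (dist (x (from_nat n)) (y (from_nat n))) 1 \<le> (1/2) ^ n * e" for n
      using assms[of "from_nat n"] by (intro mult_left_mono) (auto simp: dist_real_def)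
    show "summable (\<lambda>n. (1/2) ^ n * min (dist (x (from_nat n)) (y (from_nat n))) 1)"
      by (rule summable_comparison_test'[OF s, of 0]) (use le in auto)
  qed
  also have "\<dots> = 2 * e"
    using suminf_mult2[of "\<lambda>n. (1/2::real) ^ n" e] suminf_geometric[of "1/2::real"] by simp
  finally show ?thesis .
qed

definition sup_norm :: "nat \<Rightarrow> (nat \<Rightarrow> real) \<Rightarrow> real" where
  "sup_norm i x = Max ((\<lambda>j. \<bar>x j\<bar>) ` {..i})"

lemma sup_norm_Suc: "sup_norm (Suc i) x = max \<bar>x (Suc i)\<bar> (sup_norm i x)"
  by (simp add: sup_norm_def atMost_Suc)

lemma continuous_on_sup_norm: "continuous_on S (sup_norm i)"
proof (induction i)
  case 0
  then show ?case
    by (simp add: sup_norm_def[abs_def] continuous_on_rabs continuous_on_subset[OF continuous_on_product_coordinates])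
next
  case (Suc i)
  then show ?case
    unfolding sup_norm_Suc[abs_def]
    by (intro continuous_on_max continuous_on_rabs continuous_on_subset[OF continuous_on_product_coordinates]) auto
qed

lemma sup_norm_ge: "j \<le> i \<Longrightarrow> \<bar>x j\<bar> \<le> sup_norm i x"
  by (simp add: sup_norm_def)

lemma sup_norm_attained: "\<exists>j\<le>i. \<bar>x j\<bar> = sup_norm i x"
proof -
  have "sup_norm i x \<in> (\<lambda>j. \<bar>x j\<bar>) ` {..i}"
    unfolding sup_norm_def by (rule Max_in) auto
  then show ?thesis by auto
qed

lemma sup_norm_pos:
  assumes "x \<in> Sph i"
  shows "0 < sup_norm i x"
proof (rule ccontr)
  assume "\<not> 0 < sup_norm i x"
  then have "x j = 0" if "j \<le> i" for j
    using sup_norm_ge[OF that, of x] by linarith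
  then show False
    using assms by (simp add: nsphere)
qed

text \<open>The radial projection from the sphere to the boundary of the cube. Multiples by integers of
  its values have an integral coordinate, which saves one grid point in the count of overlapping stars.\<close>

definition to_cube :: "nat \<Rightarrow> (nat \<Rightarrow> real) \<Rightarrow> nat \<Rightarrow> real" where
  "to_cube i x = (\<lambda>j. x j / sup_norm i x)"

lemma continuous_on_to_cube: "continuous_on (Sph i) (to_cube i)"
  unfolding to_cube_def[abs_def]
proof (rule continuous_on_coordinatewise_then_product)
  fix j
  show "continuous_on (Sph i) (\<lambda>x. x j / sup_norm i x)"
    by (intro continuous_on_divide continuous_on_sup_norm continuous_on_subset[OF continuous_on_product_coordinates])
      (use sup_norm_pos in fastforce)+
qed

lemma L2_set_to_cube: "x \<in> Sph i \<Longrightarrow> L2_set (to_cube i x) {..i} = 1 / sup_norm i x"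
  using L2_set_right_distrib[of "1 / sup_norm i x" x "{..i}"] sup_norm_pos[of x i]
  by (simp add: to_cube_def Sph_iff)

lemma uniformly_continuous_to_cube:
  fixes F :: "(nat \<Rightarrow> real) \<Rightarrow> real"
  assumes "continuous_on (Sph i) F" "0 < e"
  shows "\<exists>d>0. \<forall>x\<in>Sph i. \<forall>x'\<in>Sph i. (\<forall>j. \<bar>to_cube i x j - to_cube i x' j\<bar> < d) \<longrightarrow> \<bar>F x - F x'\<bar> < e"
proof -
  let ?C = "to_cube i ` Sph i"
  define g where "g = (\<lambda>c j. if j \<le> i then c j / L2_set c {..i} else (0::real))"
  have g: "g (to_cube i x) = x" if x: "x \<in> Sph i" for x
    unfolding g_def L2_set_to_cube[OF x] using x sup_norm_pos[OF x]
    by (auto simp: to_cube_def Sph_iff fun_eq_iff)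
  have "continuous_on ?C g"
    unfolding g_def
  proof (rule continuous_on_coordinatewise_then_product)
    fix j
    have "L2_set c {..i} \<noteq> 0" if "c \<in> ?C" for c
      using that L2_set_to_cube sup_norm_pos by fastforce
    then show "continuous_on ?C (\<lambda>c. if j \<le> i then c j / L2_set c {..i} else 0)"
      by (cases "j \<le> i")
        (auto intro!: continuous_on_divide continuous_on_L2_set continuous_on_subset[OF continuous_on_product_coordinates])
  qed
  then have "continuous_on ?C (\<lambda>c. F (g c))"
    by (rule continuous_on_compose2[OF assms(1)]) (auto simp: g)
  then have "uniformly_continuous_on ?C (\<lambda>c. F (g c))"
    by (intro compact_uniformly_continuous compact_continuous_image continuous_on_to_cube compact_Sph)
  then obtain d where d: "0 < d" "\<And>c c'. \<lbrakk>c \<in> ?C; c' \<in> ?C; dist c' c < d\<rbrakk> \<Longrightarrow> dist (F (g c')) (F (g c)) < e"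
    using assms(2) unfolding uniformly_continuous_on_def by metis
  show ?thesis
  proof (intro exI[of _ "d / 3"] conjI ballI impI)
    fix x x' assume x: "x \<in> Sph i" "x' \<in> Sph i" and *: "\<forall>j. \<bar>to_cube i x j - to_cube i x' j\<bar> < d / 3"
    have "dist (to_cube i x) (to_cube i x') \<le> 2 * (d / 3)"
      using * by (intro dist_fun_le) (rule less_imp_le, blast)
    then have "dist (F (g (to_cube i x))) (F (g (to_cube i x'))) < e"
      using d(1) x by (intro d(2)) auto
    then show "\<bar>F x - F x'\<bar> < e"
      by (simp add: g x dist_real_def)
  qed (use d(1) in simp)
qed

lemma continuous_on_kuhn_hat:
  assumes "\<And>a. continuous_on S (\<lambda>x. q x a)"
  shows "continuous_on S (\<lambda>x. kuhn_hat i p (q x))"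
  unfolding kuhn_hat_def
  by (intro continuous_on_prod continuous_on_max continuous_on_diff continuous_on_const assms)

context abstract_complex
begin

text \<open>Simplicial approximation. The cube boundary is scaled by a large integer \<open>N\<close>, so that on each star
  of the grid some coordinate of \<open>f\<close> stays positive; the star is sent to that vertex. The new
  map lies in the carrier of the old one, and its values have at most as many vertices as there are
  overlapping stars.\<close>

lemma low_dimensional_approximation:
  assumes f: "continuous_map (nsphere i) (geometric_realization K) f"
  shows "\<exists>g. weight_map (nsphere i) K g \<and>
    (\<forall>x\<in>Sph i. support (g x) \<subseteq> support (f x) \<and> card (support (g x)) \<le> Suc i)"
proof -
  have w: "weight_map (nsphere i) K f"
    by (rule continuous_map_imp_weight_map[OF compact_space_nsphere f])
  then obtain W where W: "finite W" "\<And>x. x \<in> Sph i \<Longrightarrow> support (f x) \<subseteq> W"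
    by (auto simp: weight_map_def)
  have nn: "0 \<le> f x v" and fK: "support (f x) \<in> K" if "x \<in> Sph i" for x v
    using w that by (auto simp: weight_map_def)
  have fc: "continuous_on (Sph i) (\<lambda>x. f x v)" for v
    using w by (simp add: weight_map_def continuous_map_nsphere_iff)
  define e where "e = 1 / (real (card W) + 1)"
  have e: "0 < e" by (simp add: e_def)
  have big: "\<exists>v\<in>W. e < f x v" if x: "x \<in> Sph i" for x
    unfolding e_def using f x W by (intro large_coordinate) (auto simp: continuous_map_def Pi_iff)
  have "\<exists>d>0. \<forall>x\<in>Sph i. \<forall>x'\<in>Sph i. (\<forall>j. \<bar>to_cube i x j - to_cube i x' j\<bar> < d) \<longrightarrow> \<bar>f x v - f x' v\<bar> < e" for v
    by (rule uniformly_continuous_to_cube[OF fc e])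
  then obtain d where d: "\<And>v. 0 < d v"
    "\<And>v x x'. \<lbrakk>x \<in> Sph i; x' \<in> Sph i; \<And>j. \<bar>to_cube i x j - to_cube i x' j\<bar> < d v\<rbrakk> \<Longrightarrow> \<bar>f x v - f x' v\<bar> < e"
    by metis
  \<comment> \<open>the element 1 keeps the minimum meaningful when \<open>W\<close> is empty\<close>
  define D where "D = Min (insert 1 (d ` W))"
  have D: "0 < D" "\<And>v. v \<in> W \<Longrightarrow> D \<le> d v"
    using W(1) d(1) by (auto simp: D_def)
  \<comment> \<open>two points of the scaled cube in the same star differ by less than 2 in each coordinate\<close>
  obtain N :: nat where N: "2 / D < N"
    using reals_Archimedean2 by blast
  have Npos: "0 < real N"
    using N D(1) by (smt (verit) divide_pos_pos)
  define q where "q = (\<lambda>x j. real N * to_cube i x j)"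
  define L where "L = {p :: nat \<Rightarrow> int. \<forall>j. (j \<in> {..i} \<longrightarrow> p j \<in> {- int N..int N}) \<and> (j \<notin> {..i} \<longrightarrow> p j = 0)}"
  have L: "finite L"
    unfolding L_def by (rule finite_set_of_finite_funs) auto
  have L0: "p j = 0" if "p \<in> L" "i < j" for p j
    using that by (simp add: L_def)
  have q0: "q x j = 0" if "x \<in> Sph i" "i < j" for x j
    using that by (simp add: q_def to_cube_def Sph_iff)
  have qint: "\<exists>j\<le>i. q x j \<in> \<int>" if x: "x \<in> Sph i" for x
  proof -
    obtain j where j: "j \<le> i" "\<bar>x j\<bar> = sup_norm i x"
      using sup_norm_attained by blast
    then have "x j = sup_norm i x \<or> x j = - sup_norm i x" by linarith
    then have "to_cube i x j = 1 \<or> to_cube i x j = -1"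
      using sup_norm_pos[OF x] by (auto simp: to_cube_def)
    then have "q x j = of_int (int N) \<or> q x j = of_int (- int N)"
      by (auto simp: q_def)
    then show ?thesis using j(1) by (metis Ints_of_int)
  qed
  have floor: "(\<lambda>j. \<lfloor>q x j\<rfloor>) \<in> L" if x: "x \<in> Sph i" for x
  proof -
    have "\<bar>to_cube i x j\<bar> \<le> 1" if "j \<le> i" for j
      using sup_norm_ge[OF that, of x] sup_norm_pos[OF x] by (simp add: to_cube_def)
    then have "\<bar>q x j\<bar> \<le> real N" if "j \<le> i" for j
      using that by (simp add: q_def abs_mult mult_left_le)
    then have "- real N \<le> q x j" "q x j \<le> real N" if "j \<le> i" for j
      using that by (simp_all add: abs_le_iff minus_le_iff)
    then show ?thesis
      using q0[OF x] by (auto simp: L_def le_floor_iff floor_le_iff) (smt (verit) that)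
  qed
  have close: "\<bar>to_cube i x j - to_cube i x' j\<bar> < D"
    if x: "x \<in> Sph i" "x' \<in> Sph i" and p: "p \<in> L" "0 < kuhn_hat i p (q x)" "0 < kuhn_hat i p (q x')" for x x' p j
  proof (cases "j \<le> i")
    case True
    have "\<bar>q x j - p j\<bar> < 1" "\<bar>q x' j - p j\<bar> < 1"
      using x p True q0 by (auto intro!: kuhn_hat_close[of i] simp: L_def)
    then have "\<bar>q x j - q x' j\<bar> < 2" by linarith
    then have "real N * \<bar>to_cube i x j - to_cube i x' j\<bar> < 2"
      using Npos by (simp add: q_def abs_mult flip: right_diff_distrib)
    also have "2 < real N * D" using N D(1) by (simp add: field_simps)
    finally show ?thesis using Npos by simp
  next
    case False
    then show ?thesis using x D(1) by (simp add: to_cube_def Sph_iff)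
  qed
  have "\<exists>v. \<forall>x\<in>Sph i. 0 < kuhn_hat i p (q x) \<longrightarrow> 0 < f x v" if p: "p \<in> L" for p
  proof (cases "\<exists>x\<in>Sph i. 0 < kuhn_hat i p (q x)")
    case True
    then obtain x where x: "x \<in> Sph i" "0 < kuhn_hat i p (q x)" by blast
    obtain v where v: "v \<in> W" "e < f x v" using big[OF x(1)] by blast
    have "0 < f x' v" if x': "x' \<in> Sph i" "0 < kuhn_hat i p (q x')" for x'
    proof -
      have "\<bar>f x v - f x' v\<bar> < e"
        using close[OF x(1) x'(1) p x(2) x'(2)] D(2)[OF v(1)]
        by (intro d(2) x(1) x'(1)) (rule less_le_trans)
      then show ?thesis using v(2) by linarith
    qed
    then show ?thesis by blast
  qed auto
  then obtain vert where vert: "\<And>p x. \<lbrakk>p \<in> L; x \<in> Sph i; 0 < kuhn_hat i p (q x)\<rbrakk> \<Longrightarrow> 0 < f x (vert p)"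
    by metis
  define g where "g = (\<lambda>x v. \<Sum>p\<in>{p \<in> L. vert p = v}. kuhn_hat i p (q x))"
  have g_nonneg: "0 \<le> g x v" for x v
    by (simp add: g_def sum_nonneg kuhn_hat_nonneg)
  have supp: "support (g x) = vert ` {p \<in> L. 0 < kuhn_hat i p (q x)}" for x
    unfolding g_def by (rule support_fibre_sum[OF L kuhn_hat_nonneg])
  have sub: "support (g x) \<subseteq> support (f x)" if "x \<in> Sph i" for x
    using vert that by (auto simp: supp)
  have "card (support (g x)) \<le> Suc i" if x: "x \<in> Sph i" for x
  proof -
    let ?A = "{p. (\<forall>j>i. p j = 0) \<and> 0 < kuhn_hat i p (q x)}"
    obtain j where j: "j \<le> i" "q x j \<in> \<int>" using qint[OF x] by blast
    have A: "finite ?A \<and> card ?A \<le> Suc i"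
      by (rule card_kuhn_hat_pos[where q = "q x", OF _ j]) (rule q0[OF x])
    have "card (support (g x)) \<le> card {p \<in> L. 0 < kuhn_hat i p (q x)}"
      unfolding supp using L by (intro card_image_le) auto
    also have "\<dots> \<le> card ?A"
      using A L0 by (intro card_mono) blast+
    finally show ?thesis using A by simp
  qed
  moreover have "support (g x) \<noteq> {}" if "x \<in> Sph i" for x
    using floor[OF that] kuhn_hat_floor[of i "q x"] unfolding supp by blast
  then have "support (g x) \<in> K" if "x \<in> Sph i" for x
    using face_simplex[OF fK sub] that by blast
  moreover have "continuous_map (nsphere i) euclideanreal (\<lambda>x. g x v)" for v
  proof -
    have "continuous_on (Sph i) (\<lambda>x. q x a)" for a
      unfolding q_def
      by (intro continuous_on_mult continuous_on_const
          continuous_on_compose2[OF continuous_on_product_coordinates[of a] continuous_on_to_cube]) auto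
    then have "continuous_on (Sph i) (\<lambda>x. g x v)"
      unfolding g_def by (intro continuous_on_sum continuous_on_kuhn_hat)
    then show ?thesis
      by (simp add: continuous_map_nsphere_iff)
  qed
  ultimately have "weight_map (nsphere i) K g"
    using W(1) subset_trans[OF sub W(2)] g_nonneg by (intro weight_mapI[of W])
  then show ?thesis
    using sub \<open>\<And>x. x \<in> Sph i \<Longrightarrow> card (support (g x)) \<le> Suc i\<close> by blast
qed

text \<open>First move \<open>f\<close> linearly to its low-dimensional approximation \<open>g\<close>, then cone \<open>g\<close> off to a vertex
  \<open>a\<close>, which adds only one vertex to each carrier.\<close>

lemma trivial_homotopy_group_full_skeleton:
  assumes full: "\<And>\<sigma>. \<lbrakk>finite \<sigma>; \<sigma> \<noteq> {}; \<sigma> \<subseteq> \<Union>K; card \<sigma> \<le> i + 2\<rbrakk> \<Longrightarrow> \<sigma> \<in> K"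
  shows "trivial_homotopy_group i (geometric_realization K)"
proof (rule trivial_homotopy_groupI)
  fix y f assume y: "y \<in> topspace (geometric_realization K)" and f: "f \<in> based_maps i (geometric_realization K) y"
  let ?Y = "geometric_realization K"
  have fc: "continuous_map (nsphere i) ?Y f" using f by (simp add: based_maps_def)
  have w: "weight_map (nsphere i) K f"
    by (rule continuous_map_imp_weight_map[OF compact_space_nsphere fc])
  obtain g where g: "weight_map (nsphere i) K g"
      "\<And>x. x \<in> Sph i \<Longrightarrow> support (g x) \<subseteq> support (f x)"
      "\<And>x. x \<in> Sph i \<Longrightarrow> card (support (g x)) \<le> Suc i"
    using low_dimensional_approximation[OF fc] by blast
  have fK: "support (f x) \<in> K" "support (g x) \<in> K" and nn: "0 \<le> f x v" "0 \<le> g x v" if "x \<in> Sph i" for x v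
    using w g(1) that by (auto simp: weight_map_def)
  obtain a where a: "a \<in> \<Union>K"
    using fK(1)[OF nsphere_base_in_nsphere] simplex_nonempty by fastforce
  obtain W where W: "finite W" "\<And>x. x \<in> Sph i \<Longrightarrow> support (f x) \<subseteq> W"
    using w by (auto simp: weight_map_def)
  define C where "C = {0..1::real} \<times> Sph i"
  \<comment> \<open>three tent functions of \<open>t\<close>: \<open>f\<close> fades into \<open>g\<close> before \<open>t = 1/2\<close>, then \<open>g\<close> into \<open>a\<close>\<close>
  define G where "G = (\<lambda>(t, x) v. max 0 (1 - 2 * t) * f x v + min (2 * t) (2 - 2 * t) * g x v + max 0 (2 * t - 1) * of_bool (v = a))"
  have CD: "0 \<le> fst p" "fst p \<le> 1" "snd p \<in> Sph i" if "p \<in> C" for p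
    using that by (auto simp: C_def)
  have supp: "support (G p) \<in> K \<and> (\<forall>v. 0 \<le> G p v) \<and> support (G p) \<subseteq> insert a W" if p: "p \<in> C" for p
  proof -
    obtain t x where tx: "p = (t, x)" "0 \<le> t" "t \<le> 1" "x \<in> Sph i" using CD[OF p] by (cases p) auto
    have Gn: "0 \<le> G p v" for v
      using tx nn by (auto simp: G_def)
    have pos: "0 < G p v \<longleftrightarrow> (t < 1/2 \<and> 0 < f x v) \<or> (0 < t \<and> t < 1 \<and> 0 < g x v) \<or> (1/2 < t \<and> v = a)" for v
    proof -
      have "0 < A + B + E \<longleftrightarrow> 0 < A \<or> 0 < B \<or> 0 < E" if "0 \<le> A" "0 \<le> B" "0 \<le> E" for A B E :: real
        using that by linarith
      then have "0 < G p v \<longleftrightarrow> 0 < max 0 (1 - 2 * t) * f x v \<or> 0 < min (2 * t) (2 - 2 * t) * g x v \<or> 0 < max 0 (2 * t - 1) * of_bool (v = a)"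
        unfolding tx(1) G_def prod.case using tx nn[OF tx(4), of v] by simp
      then show ?thesis
        using tx nn[OF tx(4), of v] by (auto simp: zero_less_mult_iff max_def min_def split: if_splits)
    qed
    show ?thesis
    proof (cases "t \<le> 1/2")
      case True
      then have "support (G p) \<subseteq> support (f x)"
        using g(2)[OF tx(4)] by (auto simp: pos)
      moreover have "support (G p) \<noteq> {}"
      proof (cases "t = 1/2")
        case True
        then have "support (G p) = support (g x)" by (auto simp: pos)
        then show ?thesis using fK(2)[OF tx(4)] simplex_nonempty by auto
      next
        case False
        then have "support (f x) \<subseteq> support (G p)" using True by (auto simp: pos)
        then show ?thesis using simplex_nonempty[OF fK(1)[OF tx(4)]] by blast
      qed
      ultimately show ?thesis
        using face_simplex[OF fK(1)[OF tx(4)]] W(2)[OF tx(4)] Gn by blast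
    next
      case False
      then have sub: "support (G p) \<subseteq> insert a (support (g x))" by (auto simp: pos)
      have fin: "finite (support (g x))" using fK(2)[OF tx(4)] finite_simplex by blast
      have "card (support (G p)) \<le> card (insert a (support (g x)))"
        using fin sub by (intro card_mono) auto
      also have "\<dots> \<le> i + 2"
        using g(3)[OF tx(4)] card_insert_le_m1[of "i + 2" "support (g x)" a] by simp
      finally have "card (support (G p)) \<le> i + 2" .
      moreover have "finite (support (G p))" using fin sub finite_subset by blast
      moreover have "a \<in> support (G p)" using False by (simp add: pos)
      moreover have "support (G p) \<subseteq> \<Union>K"
        using sub a fK(2)[OF tx(4)] by blast
      ultimately have "support (G p) \<in> K" by (intro full) auto
      then show ?thesis
        using sub g(2)[OF tx(4)] W(2)[OF tx(4)] Gn by blast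
    qed
  qed
  have cc: "continuous_on (Sph i) (\<lambda>x. f x v)" "continuous_on (Sph i) (\<lambda>x. g x v)" for v
    using w g(1) by (simp_all add: weight_map_def continuous_map_nsphere_iff)
  have "continuous_on C (\<lambda>p. G p v)" for v
  proof -
    have "continuous_on C (\<lambda>p. f (snd p) v)" "continuous_on C (\<lambda>p. g (snd p) v)"
      using CD(3) by (auto intro!: continuous_on_compose2[OF cc(1)] continuous_on_compose2[OF cc(2)] continuous_on_snd continuous_on_id)
    then show ?thesis
      unfolding G_def case_prod_unfold
      by (intro continuous_intros continuous_on_max continuous_on_min) 
  qed
  then have "weight_map (top_of_set C) K G"
    using supp W(1) by (intro weight_mapI[of "insert a W"]) simp_all
  then have "continuous_map (top_of_set C) ?Y (\<lambda>p. barycentric (G p))"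
    by (rule weight_map_imp_continuous_map)
  then have cont: "continuous_map (prod_topology (top_of_set {0..1}) (nsphere i)) ?Y (\<lambda>p. barycentric (G p))"
    by (simp add: prod_nsphere_eq_top_of_set C_def)
  have "barycentric (G (0, x)) = f x" if "x \<in> Sph i" for x
    using weight_map_barycentric[OF fc that] by (simp add: G_def)
  moreover have "barycentric (G (1, x)) = (\<lambda>v. of_bool (v = a))" for x
    by (subst barycentric_id) (simp_all add: G_def)
  ultimately have "homotopic_with (\<lambda>_. True) (nsphere i) ?Y f (\<lambda>_ v. of_bool (v = a))"
    using cont by (subst homotopic_with) (auto intro!: exI[of _ "\<lambda>p. barycentric (G p)"])
  then show "homotopic_with (\<lambda>h. h nsphere_base = y) (nsphere i) ?Y f (\<lambda>_. y)"
    by (rule based_nullhomotopy[OF f])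
qed

end

section \<open>The Borsuk--Ulam theorem\<close>

definition skip :: "nat \<Rightarrow> nat \<Rightarrow> nat" where
  "skip m j = (if j < m then j else Suc j)"

lemma skip_simps [simp]: "m \<le> j \<Longrightarrow> skip m j = Suc j" "j < m \<Longrightarrow> skip m j = j"
  by (simp_all add: skip_def)

text \<open>The cup product of the coboundaries of the 0-cochains \<open>\<theta> 0, \<dots>, \<theta> (i - 1)\<close>, evaluated on a simplex
  with vertices \<open>u 0, \<dots>, u i\<close>.\<close>

definition cup_diff :: "(nat \<Rightarrow> 'a \<Rightarrow> int) \<Rightarrow> nat \<Rightarrow> (nat \<Rightarrow> 'a) \<Rightarrow> int" where
  "cup_diff \<theta> i u = (\<Prod>j<i. \<theta> j (u (Suc j)) - \<theta> j (u j))"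

lemma cup_diff_cong: "(\<And>j. j \<le> i \<Longrightarrow> u j = v j) \<Longrightarrow> cup_diff \<theta> i u = cup_diff \<theta> i v"
  by (simp add: cup_diff_def)

lemma cup_diff_Suc: "cup_diff \<theta> (Suc i) u = cup_diff \<theta> i u * (\<theta> i (u (Suc i)) - \<theta> i (u i))"
  by (simp add: cup_diff_def)

lemma cup_diff_cocycle: "(\<Sum>m\<le>Suc i. (-1) ^ m * cup_diff \<theta> i (u \<circ> skip m)) = 0"
proof (induction i)
  case 0
  then show ?case by (simp add: cup_diff_def)
next
  case (Suc i)
  let ?w = "\<theta> i (u (Suc (Suc i))) - \<theta> i (u (Suc i))"
  define D where "D = (\<lambda>m. cup_diff \<theta> i (u \<circ> skip m))"
  have D: "D (Suc i) = cup_diff \<theta> i u" "D (Suc (Suc i)) = cup_diff \<theta> i u"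
    by (auto intro!: cup_diff_cong simp: D_def)
  have step: "cup_diff \<theta> (Suc i) (u \<circ> skip m)
      = D m * (\<theta> i (u (skip m (Suc i))) - \<theta> i (u (skip m i)))" for m
    by (simp add: cup_diff_Suc D_def)
  have "(\<Sum>m\<le>Suc i. (-1) ^ m * D m) = 0"
    unfolding D_def by (rule Suc.IH)
  then have "(\<Sum>m\<le>i. (-1) ^ m * D m) = (-1) ^ i * cup_diff \<theta> i u"
    using D by simp
  moreover have "(\<Sum>m\<le>i. (-1) ^ m * cup_diff \<theta> (Suc i) (u \<circ> skip m)) = (\<Sum>m\<le>i. (-1) ^ m * D m) * ?w"
    by (simp add: sum_distrib_right step mult.assoc)
  ultimately show ?case
    unfolding sum.atMost_Suc by (simp only: step D) (simp add: algebra_simps)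
qed

text \<open>The cup product of \<open>cup_diff \<theta> i\<close> with the 0-cochain \<open>\<theta> i\<close>. It links consecutive
  dimensions: its coboundary is, up to sign, \<open>cup_diff \<theta> (Suc i)\<close>, while, for antipodally odd \<open>\<theta>\<close>, its
  symmetrization under the antipodal map is \<open>cup_diff \<theta> i\<close> modulo 2.\<close>

definition fundamental_cochain :: "(nat \<Rightarrow> 'a \<Rightarrow> int) \<Rightarrow> nat \<Rightarrow> (nat \<Rightarrow> 'a) \<Rightarrow> int" where
  "fundamental_cochain \<theta> i u = cup_diff \<theta> i u * \<theta> i (u i)"

text \<open>If \<open>\<theta> i\<close> were taken at \<open>u (Suc i)\<close> for every face, the sum would vanish by the cocycle
  property. The face without that vertex has \<open>\<theta> i (u i)\<close> instead, so the difference of the two values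
  remains.\<close>

lemma coboundary_fundamental_cochain:
  "(\<Sum>m\<le>Suc i. (-1) ^ m * fundamental_cochain \<theta> i (u \<circ> skip m)) = (-1) ^ i * cup_diff \<theta> (Suc i) u"
proof -
  have u: "cup_diff \<theta> i (u \<circ> skip (Suc i)) = cup_diff \<theta> i u"
    by (auto intro!: cup_diff_cong)
  have "(\<Sum>m\<le>i. (-1) ^ m * fundamental_cochain \<theta> i (u \<circ> skip m))
      = (\<Sum>m\<le>i. (-1) ^ m * cup_diff \<theta> i (u \<circ> skip m)) * \<theta> i (u (Suc i))"
    by (simp add: sum_distrib_right fundamental_cochain_def mult.assoc)
  moreover have "(\<Sum>m\<le>i. (-1) ^ m * cup_diff \<theta> i (u \<circ> skip m)) = (-1) ^ i * cup_diff \<theta> i u"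
    using cup_diff_cocycle[of \<theta> i u] unfolding sum.atMost_Suc u by simp
  ultimately show ?thesis
    by (simp add: cup_diff_Suc u fundamental_cochain_def algebra_simps)
qed

lemma fundamental_cochain_antipodal:
  assumes "\<And>j. j \<le> i \<Longrightarrow> \<theta> j (v j) = 1 - \<theta> j (u j)" "\<And>j. j < i \<Longrightarrow> \<theta> j (v (Suc j)) = 1 - \<theta> j (u (Suc j))"
  shows "fundamental_cochain \<theta> i v = (-1) ^ i * cup_diff \<theta> i u * (1 - \<theta> i (u i))"
proof -
  have "cup_diff \<theta> i v = (\<Prod>j<i. (-1) * (\<theta> j (u (Suc j)) - \<theta> j (u j)))"
    unfolding cup_diff_def using assms by (intro prod.cong) auto
  also have "\<dots> = (-1) ^ i * cup_diff \<theta> i u"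
    unfolding cup_diff_def prod.distrib by simp
  finally show ?thesis
    using assms(1)[of i] by (simp add: fundamental_cochain_def)
qed

text \<open>Evaluation of an integral cochain on a chain, written through \<^const>\<open>frag_extend\<close> to inherit
  its linearity.\<close>

definition chain_eval :: "('s \<Rightarrow> int) \<Rightarrow> ('s \<Rightarrow>\<^sub>0 int) \<Rightarrow> int" where
  "chain_eval F c = Poly_Mapping.lookup (frag_extend (\<lambda>s. frag_cmul (F s) (frag_of ())) c) ()"

lemma chain_eval_simps [simp]:
  "chain_eval F 0 = 0" "chain_eval F (frag_of s) = F s"
  "chain_eval F (a + b) = chain_eval F a + chain_eval F b"
  "chain_eval F (a - b) = chain_eval F a - chain_eval F b"
  "chain_eval F (- a) = - chain_eval F a"
  "chain_eval F (frag_cmul m a) = m * chain_eval F a"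
  by (simp_all add: chain_eval_def frag_extend_add frag_extend_diff frag_extend_minus frag_extend_cmul lookup_add lookup_minus)

lemma chain_eval_sum: "finite I \<Longrightarrow> chain_eval F (sum g I) = (\<Sum>i\<in>I. chain_eval F (g i))"
  by (induction I rule: finite_induct) auto

lemma chain_eval_eq_0: "(\<And>s. s \<in> Poly_Mapping.keys c \<Longrightarrow> F s = 0) \<Longrightarrow> chain_eval F c = 0"
  unfolding chain_eval_def by (subst frag_extend_eq_0) auto

abbreviation vertices :: "((nat \<Rightarrow> real) \<Rightarrow> 'a) \<Rightarrow> nat \<Rightarrow> 'a" where
  "vertices f \<equiv> (\<lambda>j. simplicial_vertex j f)"

lemma vertex_singular_face:
  assumes "j \<le> p"
  shows "simplicial_vertex j (singular_face (Suc p) m f) = simplicial_vertex (skip m j) f"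
proof -
  have "simplical_face m (\<lambda>i. if i = j then 1 else (0::real)) = (\<lambda>i. if i = skip m j then 1 else 0)"
    by (auto simp: simplical_face_def skip_def fun_eq_iff)
  then show ?thesis
    using assms by (simp add: simplicial_vertex_def singular_face_def)
qed

lemma vertex_simplex_map:
  "j \<le> p \<Longrightarrow> simplicial_vertex j (simplex_map p g f) = g (simplicial_vertex j f)"
  by (simp add: simplicial_vertex_def simplex_map_def)

lemma vertex_in_topspace:
  assumes "singular_simplex p X f" "j \<le> p"
  shows "simplicial_vertex j f \<in> topspace X"
  using assms by (auto simp: simplicial_vertex_def singular_simplex_def continuous_map_def Pi_iff)

lemma fundamental_cochain_boundary:
  assumes "singular_chain (Suc i) X c"
  shows "chain_eval (\<lambda>f. fundamental_cochain \<theta> i (vertices f)) (chain_boundary (Suc i) c)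
       = (-1) ^ i * chain_eval (\<lambda>f. cup_diff \<theta> (Suc i) (vertices f)) c"
  using assms unfolding singular_chain_def
proof (induction c rule: frag_induction)
  case (one f)
  have "fundamental_cochain \<theta> i (vertices (singular_face (Suc i) m f))
      = fundamental_cochain \<theta> i (vertices f \<circ> skip m)" for m
    using vertex_singular_face[of _ i m f]
    by (simp add: fundamental_cochain_def o_def cong: cup_diff_cong)
  then show ?case
    using coboundary_fundamental_cochain[of \<theta> i "vertices f"]
    by (simp add: chain_boundary_of chain_eval_sum del: sum.atMost_Suc)
qed (auto simp: chain_boundary_diff algebra_simps)

text \<open>The labels stand for signs, 1 for plus and 0 for minus, so the opposite sign is the difference
  from 1.\<close>

locale odd_labelling =
  fixes X :: "'a topology" and \<tau> :: "'a \<Rightarrow> 'a" and \<theta> :: "nat \<Rightarrow> 'a \<Rightarrow> int"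
  assumes cont: "continuous_map X X \<tau>"
    and odd: "x \<in> topspace X \<Longrightarrow> \<theta> j (\<tau> x) = 1 - \<theta> j x"
begin

lemma fundamental_cochain_symmetrized:
  assumes "singular_chain i X c"
  shows "even (chain_eval (\<lambda>f. fundamental_cochain \<theta> i (vertices f)) (c + frag_cmul (- ((-1) ^ i)) (chain_map i \<tau> c))
            - chain_eval (\<lambda>f. cup_diff \<theta> i (vertices f)) c)"
  using assms unfolding singular_chain_def
proof (induction c rule: frag_induction)
  case (one f)
  have v: "simplicial_vertex j (simplex_map i \<tau> f) = \<tau> (simplicial_vertex j f)" if "j \<le> i" for j
    using that by (rule vertex_simplex_map)
  have "fundamental_cochain \<theta> i (vertices (simplex_map i \<tau> f))
      = (-1) ^ i * cup_diff \<theta> i (vertices f) * (1 - \<theta> i (simplicial_vertex i f))"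
    by (rule fundamental_cochain_antipodal) (use one in \<open>auto simp: v odd vertex_in_topspace\<close>)
  then have "(-1) ^ i * fundamental_cochain \<theta> i (vertices (simplex_map i \<tau> f))
      = cup_diff \<theta> i (vertices f) * (1 - \<theta> i (simplicial_vertex i f))"
    by (simp flip: mult.assoc power_mult_distrib)
  then show ?case
    by (simp add: fundamental_cochain_def algebra_simps)
next
  case (diff a b)
  then show ?case
    by (simp add: chain_map_diff algebra_simps) argo
qed auto

text \<open>Hemispheres of increasing dimension: a point, a path between the point and its antipode, a disc
  bounded by the path and its antipodal path, and so on. The boundary of each is the sphere made up of the
  previous hemisphere and its antipode.\<close>

inductive antipodal_chain :: "nat \<Rightarrow> 'a chain \<Rightarrow> bool" where
  zero: "singular_simplex 0 X f \<Longrightarrow> antipodal_chain 0 (frag_of f)"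
| Suc: "\<lbrakk>antipodal_chain i z; singular_chain (Suc i) X c;
        chain_boundary (Suc i) c = z + frag_cmul (- ((-1) ^ i)) (chain_map i \<tau> z)\<rbrakk>
       \<Longrightarrow> antipodal_chain (Suc i) c"

lemma antipodal_chain_imp_chain: "antipodal_chain i c \<Longrightarrow> singular_chain i X c"
  by (induction rule: antipodal_chain.induct) (auto simp: singular_chain_of)

text \<open>Evaluate the fundamental cochain on the boundary of \<open>c\<close>. As a coboundary this is, up to sign, the
  product \<open>cup_diff \<theta> (Suc i)\<close> on \<open>c\<close>. Since the boundary is the symmetrization of the previous chain
  \<open>z\<close>, it is also congruent to the product in the lower dimension on \<open>z\<close>.\<close>

lemma antipodal_chain_odd:
  assumes "antipodal_chain i c"
  shows "odd (chain_eval (\<lambda>f. cup_diff \<theta> i (vertices f)) c)"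
  using assms
proof induction
  case (zero f)
  then show ?case by (simp add: cup_diff_def)
next
  case (Suc i z c)
  have "odd (chain_eval (\<lambda>f. fundamental_cochain \<theta> i (vertices f)) (chain_boundary (Suc i) c))"
    using fundamental_cochain_symmetrized[OF antipodal_chain_imp_chain[OF Suc.hyps(1)]] Suc.IH Suc.hyps(3)
    by simp
  then show ?case
    using fundamental_cochain_boundary[OF Suc.hyps(2), of \<theta>] by simp
qed

lemma antipodal_chain_subdivision:
  "antipodal_chain i c \<Longrightarrow> antipodal_chain i (singular_subdivision i c)"
proof (induction rule: antipodal_chain.induct)
  case (zero f)
  then show ?case
    by (simp add: singular_subdivision_zero[of X] singular_chain_of antipodal_chain.zero)
next
  case (Suc i z c)
  have z: "singular_chain i X z"
    using Suc.hyps(1) by (rule antipodal_chain_imp_chain)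
  have cm: "singular_subdivision i (frag_cmul m a) = frag_cmul m (singular_subdivision i a)" for m a
    by (simp add: singular_subdivision_def frag_extend_cmul)
  show ?case
  proof (rule antipodal_chain.Suc[OF Suc.IH])
    show "singular_chain (Suc i) X (singular_subdivision (Suc i) c)"
      using Suc.hyps(2) by (rule singular_chain_singular_subdivision)
    show "chain_boundary (Suc i) (singular_subdivision (Suc i) c)
        = singular_subdivision i z + frag_cmul (- ((-1) ^ i)) (chain_map i \<tau> (singular_subdivision i z))"
      using chain_boundary_singular_subdivision[OF Suc.hyps(2)] Suc.hyps(3) naturality_singular_subdivision[OF z, of \<tau>]
      by (simp add: singular_subdivision_add cm)
  qed
qed

lemma antipodal_chain_subdivision_power:
  "antipodal_chain i c \<Longrightarrow> antipodal_chain i ((singular_subdivision i ^^ n) c)"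
  by (induction n) (auto intro: antipodal_chain_subdivision)

text \<open>After subdivision each simplex of the chain lies in one set of the cover, on which some factor
  of the product \<open>cup_diff\<close> vanishes; but subdivision keeps its value on the chain odd.\<close>

proposition no_antipodal_chain:
  assumes "antipodal_chain k c"
    and op: "\<And>U. U \<in> \<C> \<Longrightarrow> openin X U" and cov: "topspace X \<subseteq> \<Union>\<C>"
    and const: "\<And>U. U \<in> \<C> \<Longrightarrow> \<exists>j<k. \<forall>x\<in>U. \<forall>y\<in>U. \<theta> j x = \<theta> j y"
  shows False
proof -
  obtain n where n: "\<And>m f. \<lbrakk>n \<le> m; f \<in> Poly_Mapping.keys ((singular_subdivision k ^^ m) c)\<rbrakk>
                      \<Longrightarrow> \<exists>V \<in> \<C>. f \<in> (standard_simplex k) \<rightarrow> V"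
    using sufficient_iterated_singular_subdivision_exists[OF _ cov antipodal_chain_imp_chain[OF assms(1)]] op
    by blast
  let ?c = "(singular_subdivision k ^^ n) c"
  have "cup_diff \<theta> k (vertices f) = 0" if f: "f \<in> Poly_Mapping.keys ?c" for f
  proof -
    obtain V where V: "V \<in> \<C>" "f \<in> standard_simplex k \<rightarrow> V"
      using n[OF order_refl f] by blast
    then obtain j where j: "j < k" "\<forall>x\<in>V. \<forall>y\<in>V. \<theta> j x = \<theta> j y"
      using const by blast
    have "simplicial_vertex i f \<in> V" if "i \<le> k" for i
      using V(2) that by (auto simp: simplicial_vertex_def)
    then have "\<theta> j (simplicial_vertex (Suc j) f) - \<theta> j (simplicial_vertex j f) = 0"
      using j by simp
    then show ?thesis
      unfolding cup_diff_def using j(1) by (intro prod_zero) auto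
  qed
  then show False
    using antipodal_chain_odd[OF antipodal_chain_subdivision_power[OF assms(1)]]
    by (metis chain_eval_eq_0 even_zero)
qed

text \<open>The symmetrization of an antipodal chain is a cycle, hence bounds when the homology vanishes.\<close>

lemma antipodal_chain_exists:
  assumes inv: "\<And>x. x \<in> topspace X \<Longrightarrow> \<tau> (\<tau> x) = x"
    and f: "singular_simplex 0 X f" "homologous_rel 0 X {} (frag_of f) (frag_of (simplex_map 0 \<tau> f))"
    and acyc: "\<And>i. \<lbrakk>0 < i; i < k\<rbrakk> \<Longrightarrow> trivial_group (homology_group (int i) X)"
    and "i \<le> k"
  shows "\<exists>c. antipodal_chain i c"
  using \<open>i \<le> k\<close>
proof (induction i)
  case 0
  then show ?case using f(1) antipodal_chain.zero by blast
next
  case (Suc i)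
  show ?case
  proof (cases i)
    case 0
    from f(2) obtain d where d: "singular_chain (Suc 0) X d"
        "chain_boundary (Suc 0) d = frag_of f - frag_of (simplex_map 0 \<tau> f)"
      unfolding homologous_rel_def singular_boundary by blast
    have "antipodal_chain (Suc 0) d"
      by (rule antipodal_chain.Suc[OF antipodal_chain.zero[OF f(1)] d(1)]) (simp add: d(2))
    then show ?thesis using 0 by blast
  next
    case (Suc i')
    obtain c where c: "antipodal_chain i c"
      using Suc.IH Suc.prems by auto
    from c obtain z where z: "antipodal_chain i' z" "chain_boundary i c = z + frag_cmul (- ((-1) ^ i')) (chain_map i' \<tau> z)"
      unfolding Suc by cases auto
    have sc: "singular_chain i X c" "singular_chain i' X z"
      using c z antipodal_chain_imp_chain by auto
    let ?a = "c + frag_cmul (- ((-1) ^ i)) (chain_map i \<tau> c)"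
    have "chain_map i' (\<tau> \<circ> \<tau>) z = z"
      using sc(2) chain_map_id_gen[of i' X z "\<tau> \<circ> \<tau>"] inv by simp
    then have tt: "chain_map i' \<tau> (chain_map i' \<tau> z) = z"
      by (simp add: chain_map_compose)
    have bc: "chain_boundary i (chain_map i \<tau> c) = chain_map i' \<tau> (chain_boundary i c)"
      using chain_boundary_chain_map[OF sc(1), of \<tau>] Suc by simp
    have "chain_boundary i ?a = 0"
      unfolding chain_boundary_add chain_boundary_cmul bc z(2) chain_map_add chain_map_cmul tt
      by (cases "even i'") (simp_all add: Suc)
    moreover have "singular_chain i X ?a"
      using sc(1) cont by (intro singular_chain_add singular_chain_cmul singular_chain_chain_map)
    ultimately have cyc: "singular_relcycle i X {} ?a"
      by (simp add: singular_cycle)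
    have "carrier (homology_group (int i) X) = {\<one>\<^bsub>homology_group (int i) X\<^esub>}"
      using acyc[of i] Suc Suc.prems by (simp add: trivial_group_def)
    then have "homologous_rel_set i X {} ?a = homologous_rel_set i X {} 0"
      using cyc singular_relcycle_0[of i X "{}"] unfolding carrier_relative_homology_group
      by (metis (no_types, lifting) imageI mem_Collect_eq singletonD)
    then have "homologous_rel i X {} ?a 0"
      by (simp add: homologous_rel_set_eq)
    then obtain d where "singular_chain (Suc i) X d" "chain_boundary (Suc i) d = ?a"
      by (auto simp: homologous_rel_def singular_boundary)
    then show ?thesis
      using antipodal_chain.Suc[OF c] by blast
  qed
qed

end

lemma path_connected_hemisphere:
  "path_connected_space (subtopology (nsphere n) {x. 0 \<le> x n})"
  using contractible_space_upper_hemisphere by (rule contractible_imp_path_connected_space) simp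

lemma antipode_in_nsphere: "(\<lambda>i. - x i) \<in> topspace (nsphere n) \<longleftrightarrow> x \<in> topspace (nsphere n)"
  by (simp add: nsphere)

lemma continuous_map_antipode: "continuous_map (nsphere n) (nsphere n) (\<lambda>x i. - x i)"
proof -
  have "continuous_map (nsphere n) (powertop_real UNIV) (\<lambda>x i. - x i)"
    by (auto simp: continuous_map_componentwise_UNIV intro!: continuous_map_minus continuous_map_nsphere_projection)
  moreover have "(\<lambda>i. - x i) \<in> {x. (\<Sum>i\<le>n. (x i)\<^sup>2) = 1 \<and> (\<forall>i>n. x i = 0)}" if "x \<in> topspace (nsphere n)" for x
    using that by (simp add: nsphere)
  ultimately show ?thesis
    by (subst (2) nsphere) (auto simp: continuous_map_in_subtopology)
qed

text \<open>Label \<open>x\<close> by the signs of the \<open>h j x\<close>. The sets where a given \<open>h j\<close> has a given strict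
  sign form an open cover, and on each of them one label is constant. Where \<open>h j\<close> vanishes, the label
  must still be odd, so the sign of the first nonzero coordinate of \<open>x\<close> takes over.\<close>

theorem Borsuk_Ulam:
  fixes h :: "nat \<Rightarrow> (nat \<Rightarrow> real) \<Rightarrow> real"
  assumes h_cont: "\<And>j. j < k \<Longrightarrow> continuous_map (nsphere k) euclideanreal (h j)"
    and h_odd: "\<And>j x. \<lbrakk>j < k; x \<in> topspace (nsphere k)\<rbrakk> \<Longrightarrow> h j (\<lambda>i. - x i) = - h j x"
  shows "\<exists>x \<in> topspace (nsphere k). \<forall>j<k. h j x = 0"
proof (rule ccontr)
  assume "\<not> ?thesis"
  then have nz: "\<exists>j<k. h j x \<noteq> 0" if "x \<in> topspace (nsphere k)" for x
    using that by blast
  let ?X = "nsphere k" and ?\<tau> = "\<lambda>x i. - x i :: real"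
  define pos where "pos = (\<lambda>x::nat \<Rightarrow> real. 0 < x (LEAST i. x i \<noteq> 0))"
  define \<theta> where "\<theta> = (\<lambda>j x. if j < k \<and> h j x \<noteq> 0 then of_bool (0 < h j x) else (of_bool (pos x) :: int))"
  have pos_odd: "pos (?\<tau> x) \<longleftrightarrow> \<not> pos x" if x: "x \<in> topspace ?X" for x
  proof -
    have "\<exists>i. x i \<noteq> 0"
    proof (rule ccontr)
      assume "\<not> ?thesis"
      then show False using x by (simp add: nsphere)
    qed
    then have "x (LEAST i. x i \<noteq> 0) \<noteq> 0"
      by (rule LeastI_ex)
    then show ?thesis by (auto simp: pos_def)
  qed
  interpret odd_labelling ?X ?\<tau> \<theta>
  proof
    show "\<theta> j (?\<tau> x) = 1 - \<theta> j x" if "x \<in> topspace ?X" for j x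
      using that by (auto simp: \<theta>_def h_odd pos_odd)
  qed (rule continuous_map_antipode)
  define U where "U = (\<lambda>j s. {x \<in> topspace ?X. 0 < s * h j x})"
  let ?\<C> = "{U j s |j s. j < k \<and> s \<in> {1, -1}}"
  have "\<exists>c. antipodal_chain k c"
  proof (rule antipodal_chain_exists)
    \<comment> \<open>the last coordinate of this point is 0, so the point and its antipode lie in one closed hemisphere\<close>
    let ?e = "\<lambda>i::nat. if i = 0 then 1 else (0::real)"
    define f where "f = (\<lambda>_\<in>standard_simplex 0. ?e)"
    show f: "singular_simplex 0 ?X f"
      by (simp add: f_def singular_simplex_def in_topspace_nsphere)
    show "homologous_rel 0 ?X {} (frag_of f) (frag_of (simplex_map 0 ?\<tau> f))"
    proof -
      have "k > 0" using nz[OF in_topspace_nsphere] by auto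
      let ?H = "subtopology ?X {x. 0 \<le> x k}"
      have "?e \<in> topspace ?H" "?\<tau> ?e \<in> topspace ?H"
        using \<open>k > 0\<close> in_topspace_nsphere[of k] antipode_in_nsphere[of ?e k] by auto
      moreover have f': "simplex_map 0 ?\<tau> f = (\<lambda>_\<in>standard_simplex 0. ?\<tau> ?e)"
        by (auto simp: simplex_map_def f_def)
      ultimately have "singular_simplex 0 ?H f" "singular_simplex 0 ?H (simplex_map 0 ?\<tau> f)"
        by (simp_all add: singular_simplex_def f' f_def)
      then have "homologous_rel 0 ?H {} (frag_of f) (frag_of (simplex_map 0 ?\<tau> f))"
        by (rule iso_integer_zeroth_homology_group_aux[OF path_connected_hemisphere])
      then show ?thesis
        using singular_boundary_mono[of "{x. 0 \<le> x k}" UNIV] by (simp add: homologous_rel_def)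
    qed
    show "trivial_group (homology_group (int i) ?X)" if "0 < i" "i < k" for i
      using that trivial_reduced_homology_group_nsphere[of "int i" k] un_reduced_homology_group[of "int i" ?X] by simp
  qed (auto)
  then obtain c where "antipodal_chain k c" by blast
  then show False
  proof (rule no_antipodal_chain[where \<C> = ?\<C>])
    show "openin ?X V" if "V \<in> ?\<C>" for V
    proof -
      obtain j s where V: "V = U j s" "j < k" using \<open>V \<in> ?\<C>\<close> by auto
      have "continuous_map ?X euclideanreal (\<lambda>x. s * h j x)"
        using h_cont[OF V(2)] by (intro continuous_map_real_mult) auto
      from openin_continuous_map_preimage[OF this, of "{0<..}"] show ?thesis
        by (simp add: V U_def)
    qed
    show "topspace ?X \<subseteq> \<Union>?\<C>"
    proof
      fix x assume x: "x \<in> topspace ?X"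
      then obtain j where "j < k" "h j x \<noteq> 0" using nz by blast
      then have "x \<in> U j 1 \<or> x \<in> U j (-1)" using x by (auto simp: U_def)
      then show "x \<in> \<Union>?\<C>" using \<open>j < k\<close> by blast
    qed
    show "\<exists>j<k. \<forall>x\<in>V. \<forall>y\<in>V. \<theta> j x = \<theta> j y" if "V \<in> ?\<C>" for V
    proof -
      obtain j s where V: "V = U j s" "j < k" "s = 1 \<or> s = -1" using \<open>V \<in> ?\<C>\<close> by blast
      then show ?thesis by (intro exI[of _ j]) (auto simp: U_def \<theta>_def)
    qed
  qed
qed

section \<open>Neighbourhood complexes and colourings\<close>

locale symmetric_graph =
  fixes V :: "'v set" and adj :: "'v \<Rightarrow> 'v \<Rightarrow> bool"
  assumes adj_sym: "adj u v \<Longrightarrow> adj v u"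
begin

definition neighbourhood_complex :: "'v set set" where
  "neighbourhood_complex = {\<sigma>. finite \<sigma> \<and> \<sigma> \<noteq> {} \<and> \<sigma> \<subseteq> V \<and> (\<exists>w\<in>V. \<forall>v\<in>\<sigma>. adj v w)}"

abbreviation (input) N :: "'v set set" where "N \<equiv> neighbourhood_complex"

sublocale abstract_complex neighbourhood_complex
  by unfold_locales (auto simp: neighbourhood_complex_def intro: finite_subset)

lemma neighbourhood_complex_subset: "\<sigma> \<in> N \<Longrightarrow> \<sigma> \<subseteq> V"
  by (simp add: neighbourhood_complex_def)

definition fully_adjacent :: "'v set \<Rightarrow> 'v set \<Rightarrow> bool" where
  "fully_adjacent A B \<longleftrightarrow> (\<forall>u\<in>A. \<forall>v\<in>B. adj u v)"

lemma fully_adjacent_sym: "fully_adjacent A B \<Longrightarrow> fully_adjacent B A"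
  by (auto simp: fully_adjacent_def intro: adj_sym)

lemma fully_adjacent_simplex:
  assumes "fully_adjacent A B" "A \<in> N" "finite B" "B \<noteq> {}" "B \<subseteq> V"
  shows "B \<in> N"
proof -
  obtain v where "v \<in> A" "v \<in> V"
    using assms(2) simplex_nonempty neighbourhood_complex_subset by blast
  then have "\<forall>u\<in>B. adj u v"
    using assms(1) adj_sym by (auto simp: fully_adjacent_def)
  then show ?thesis
    using assms \<open>v \<in> V\<close> by (auto simp: neighbourhood_complex_def)
qed

text \<open>A continuous choice of common neighbours. The support of \<open>H z\<close> may grow under small changes of
  \<open>z\<close>, which destroys common neighbours; the coordinates above the threshold \<open>e\<close>, however, stay within
  the support of \<open>H z\<close>. For a simplex \<open>\<sigma>\<close> let \<open>\<rho> \<sigma>\<close> be positive when all coordinates outside \<open>\<sigma>\<close>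
  are below \<open>e\<close>, and give the weight \<open>\<rho> \<sigma>\<close> to a fixed common neighbour of \<open>\<sigma>\<close>.\<close>

lemma adjacent_selection:
  assumes H: "continuous_map X (geometric_realization N) H" and X: "compact_space X"
  shows "\<exists>e t. 0 < e \<and> weight_map X N (\<lambda>z v. max 0 (H z v - e)) \<and> weight_map X N t \<and>
    (\<forall>z\<in>topspace X. fully_adjacent {v. e < H z v} (support (t z)))"
proof -
  have w: "weight_map X N H"
    by (rule continuous_map_imp_weight_map[OF X H])
  then obtain W where W: "finite W" "\<And>z. z \<in> topspace X \<Longrightarrow> support (H z) \<subseteq> W"
    by (auto simp: weight_map_def)
  have nn: "0 \<le> H z v" and HN: "support (H z) \<in> N" if "z \<in> topspace X" for z v
    using w that by (auto simp: weight_map_def)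
  have Hc: "continuous_map X euclideanreal (\<lambda>z. H z v)" for v
    using w by (simp add: weight_map_def)
  define e where "e = 1 / (real (card W) + 1)"
  have e: "0 < e" by (simp add: e_def)
  have big: "\<exists>v\<in>W. e < H z v" if z: "z \<in> topspace X" for z
    unfolding e_def using H z W by (intro large_coordinate) (auto simp: continuous_map_def Pi_iff)
  have supp_thr: "support (\<lambda>v. max 0 (H z v - e)) = {v. e < H z v}" for z
    by (auto simp: less_max_iff_disj)
  have thr: "weight_map X N (\<lambda>z v. max 0 (H z v - e))"
  proof (rule weight_mapI[OF W(1)])
    fix z assume z: "z \<in> topspace X"
    have sub: "{v. e < H z v} \<subseteq> support (H z)" using e by auto
    then show "support (\<lambda>v. max 0 (H z v - e)) \<subseteq> W"
      unfolding supp_thr using W(2)[OF z] by (rule subset_trans)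
    show "support (\<lambda>v. max 0 (H z v - e)) \<in> N"
      unfolding supp_thr using big[OF z] by (intro face_simplex[OF HN[OF z] sub]) auto
  next
    fix v
    show "continuous_map X euclideanreal (\<lambda>z. max 0 (H z v - e))"
      by (intro continuous_map_real_max continuous_map_diff Hc) auto
  qed simp
  have "\<exists>w\<in>V. \<forall>v\<in>\<sigma>. adj v w" if "\<sigma> \<in> N" for \<sigma>
    using that by (simp add: neighbourhood_complex_def)
  then obtain nb where nb: "\<And>\<sigma>. \<sigma> \<in> N \<Longrightarrow> nb \<sigma> \<in> V" "\<And>\<sigma> v. \<lbrakk>\<sigma> \<in> N; v \<in> \<sigma>\<rbrakk> \<Longrightarrow> adj v (nb \<sigma>)"
    by metis
  define F where "F = {\<sigma> \<in> N. \<sigma> \<subseteq> W}"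
  have F: "finite F"
    using W(1) by (simp add: F_def finite_subset[of _ "Pow W"] subset_iff)
  define \<rho> where "\<rho> = (\<lambda>\<sigma> z. \<Prod>v\<in>W - \<sigma>. max 0 (e - H z v))"
  have \<rho>_nonneg: "0 \<le> \<rho> \<sigma> z" for \<sigma> z
    by (simp add: \<rho>_def prod_nonneg)
  have \<rho>_pos: "\<forall>v\<in>W - \<sigma>. H z v < e" if "0 < \<rho> \<sigma> z" for \<sigma> z
  proof -
    have "\<rho> \<sigma> z \<noteq> 0" using that by simp
    then have "\<forall>v\<in>W - \<sigma>. max 0 (e - H z v) \<noteq> 0"
      using W(1) by (simp add: \<rho>_def)
    moreover have "max 0 (e - y) \<noteq> 0 \<Longrightarrow> y < e" for y by linarith
    ultimately show ?thesis by blast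
  qed
  define t where "t = (\<lambda>z u. \<Sum>\<sigma>\<in>{\<sigma> \<in> F. nb \<sigma> = u}. \<rho> \<sigma> z)"
  have t_nonneg: "0 \<le> t z u" for z u
    by (simp add: t_def sum_nonneg \<rho>_nonneg)
  have supp_t: "support (t z) = nb ` {\<sigma> \<in> F. 0 < \<rho> \<sigma> z}" for z
    unfolding t_def by (rule support_fibre_sum[OF F \<rho>_nonneg])
  have adj_t: "fully_adjacent {v. e < H z v} (support (t z))" if z: "z \<in> topspace X" for z
    unfolding fully_adjacent_def
  proof (intro ballI)
    fix u v assume v: "v \<in> {v. e < H z v}" and "u \<in> support (t z)"
    then obtain \<sigma> where s: "\<sigma> \<in> F" "0 < \<rho> \<sigma> z" "u = nb \<sigma>"
      by (auto simp: supp_t)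
    have "v \<in> W" using v e W(2)[OF z] by force
    then have "v \<in> \<sigma>" using \<rho>_pos[OF s(2)] v by force
    then show "adj v u" using nb(2) s by (auto simp: F_def)
  qed
  have "weight_map X N t"
  proof (rule weight_mapI[of "nb ` F"])
    fix z assume z: "z \<in> topspace X"
    show sub: "support (t z) \<subseteq> nb ` F" by (auto simp: supp_t)
    have "support (H z) \<in> F"
      using HN[OF z] W(2)[OF z] by (simp add: F_def)
    moreover have "0 < \<rho> (support (H z)) z"
      unfolding \<rho>_def using nn[OF z] e by (intro prod_pos) (auto simp: not_less)
    ultimately have ne: "support (t z) \<noteq> {}" unfolding supp_t by blast
    have "{v. e < H z v} \<in> N"
      using thr z by (simp add: weight_map_def supp_thr)
    then show "support (t z) \<in> N"
    proof (rule fully_adjacent_simplex[OF adj_t[OF z]])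
      show "finite (support (t z))" using sub F finite_subset by blast
      show "support (t z) \<subseteq> V" using nb(1) sub by (auto simp: F_def)
    qed (rule ne)
  next
    fix v
    show "continuous_map X euclideanreal (\<lambda>z. t z v)"
      unfolding t_def \<rho>_def using F W(1)
      by (intro continuous_map_sum continuous_map_prod continuous_map_real_max continuous_map_diff Hc) auto
  qed (use F t_nonneg in auto)
  then show ?thesis
    using e thr adj_t by blast
qed

text \<open>A null-homotopy of \<open>s\<close>, with small coordinates cut off, gives \<open>S\<close>, in the role of the upper
  hemisphere of the next sphere. The companion \<open>T\<close> for the lower hemisphere, carried by common neighbours
  of \<open>S\<close>, starts at the antipodal value of \<open>S\<close> and ends at a constant. The height splits into three
  stages. In the first (\<open>\<beta>\<close> increases) \<open>S\<close> rests and \<open>T\<close> moves linearly from the antipodal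
  value to the selected neighbours \<open>t\<close>; in the second (\<open>\<alpha>\<close> increases) \<open>S\<close> runs through the null-homotopy
  and \<open>T\<close> follows; in the third (\<open>\<gamma>\<close> increases) \<open>S\<close> is constant and \<open>T\<close> moves to one vertex.\<close>

lemma antipodally_adjacent_cylinder:
  assumes s: "continuous_map (nsphere i) (geometric_realization N) s"
    and adj: "\<And>x. x \<in> Sph i \<Longrightarrow> fully_adjacent (support (s x)) (support (s (\<lambda>j. - x j)))"
    and triv: "trivial_homotopy_group i (geometric_realization N)"
  shows "\<exists>S T. weight_map (top_of_set ({0..1::real} \<times> Sph i)) N S \<and> weight_map (top_of_set ({0..1::real} \<times> Sph i)) N T \<and>
    (\<forall>z\<in>{0..1::real} \<times> Sph i. fully_adjacent (support (S z)) (support (T z))) \<and>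
    (\<forall>x\<in>Sph i. T (0, x) = S (0, \<lambda>j. - x j) \<and> fully_adjacent (support (S (0, x))) (support (S (0, \<lambda>j. - x j)))) \<and>
    (\<exists>a b. \<forall>x\<in>Sph i. S (1, x) = a \<and> T (1, x) = b)"
proof -
  let ?Y = "geometric_realization N"
  define C where "C = {0..1::real} \<times> Sph i"
  obtain H where H: "continuous_map (prod_topology (top_of_set {0..1::real}) (nsphere i)) ?Y H"
      "\<And>x. H (0, x) = s x" "\<And>x. H (1, x) = s nsphere_base"
    using trivial_homotopy_groupD[OF triv s] unfolding homotopic_with_def by blast
  have top: "topspace (prod_topology (top_of_set {0..1::real}) (nsphere i)) = C"
    by (simp add: C_def)
  obtain e t where e: "0 < e" and thr: "weight_map (prod_topology (top_of_set {0..1::real}) (nsphere i)) N (\<lambda>z v. max 0 (H z v - e))"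
    and t: "weight_map (prod_topology (top_of_set {0..1::real}) (nsphere i)) N t"
    and tadj: "\<And>z. z \<in> C \<Longrightarrow> fully_adjacent {v. e < H z v} (support (t z))"
    using adjacent_selection[OF H(1) compact_space_cylinder] unfolding top by blast
  define h where "h = (\<lambda>z v. max 0 (H z v - e))"
  have thr: "weight_map (top_of_set C) N h" and t: "weight_map (top_of_set C) N t"
    using thr t unfolding prod_nsphere_eq_top_of_set C_def h_def by blast+
  have supp_h: "support (h z) = {v. e < H z v}" for z
    by (auto simp: h_def less_max_iff_disj)
  obtain W1 W2 where W: "finite W1" "\<And>z. z \<in> C \<Longrightarrow> support (h z) \<subseteq> W1" "finite W2" "\<And>z. z \<in> C \<Longrightarrow> support (t z) \<subseteq> W2"
    using thr t unfolding weight_map_def by auto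
  have hN: "support (h z) \<in> N" and tN: "support (t z) \<in> N" and nn: "0 \<le> h z v" "0 \<le> t z v" if "z \<in> C" for z v
    using thr t that by (auto simp: weight_map_def)
  have hc: "continuous_on C (\<lambda>z. h z v)" and tc: "continuous_on C (\<lambda>z. t z v)" for v
    using thr t by (auto simp: weight_map_def)
  have bC: "(1, nsphere_base) \<in> C"
    using nsphere_base_in_nsphere by (simp add: C_def)
  obtain w0 where w0: "w0 \<in> support (t (1, nsphere_base))"
    using simplex_nonempty[OF tN[OF bC]] by blast
  have w0V: "w0 \<in> V"
    using w0 neighbourhood_complex_subset[OF tN[OF bC]] by blast
  define \<alpha> \<beta> \<gamma> :: "real \<Rightarrow> real" where "\<alpha> = (\<lambda>u. max 0 (min 1 (3 * u - 1)))"
    and "\<beta> = (\<lambda>u. min 1 (3 * u))" and "\<gamma> = (\<lambda>u. max 0 (3 * u - 2))"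
  define m where "m = (\<lambda>z :: real \<times> (nat \<Rightarrow> real). (\<alpha> (fst z), snd z))"
  define r where "r = (\<lambda>z :: real \<times> (nat \<Rightarrow> real). (0 :: real, \<lambda>j. - snd z j))"
  define S where "S = (\<lambda>z. h (m z))"
  define T where "T = (\<lambda>z v. (1 - \<gamma> (fst z)) * ((1 - \<beta> (fst z)) * h (r z) v + \<beta> (fst z) * t (m z) v)
      + \<gamma> (fst z) * of_bool (v = w0))"
  have m: "m z \<in> C" and r: "r z \<in> C" if "z \<in> C" for z
    using that by (auto simp: m_def r_def C_def \<alpha>_def mem_Times_iff antipode_in_nsphere)
  have snd_cont: "continuous_on C (\<lambda>z. snd z j)" for j
    by (rule continuous_on_compose2[OF continuous_on_product_coordinates[of j] continuous_on_snd[OF continuous_on_id]]) simp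
  have mc: "continuous_on C m"
    unfolding m_def \<alpha>_def
    by (intro continuous_on_Pair continuous_on_max continuous_on_min continuous_on_diff continuous_on_mult
        continuous_on_const continuous_on_fst continuous_on_snd continuous_on_id)
  have rc: "continuous_on C r"
    unfolding r_def
    by (intro continuous_on_Pair continuous_on_const continuous_on_coordinatewise_then_product continuous_on_minus snd_cont)
  have abc: "continuous_on C (\<lambda>z. \<beta> (fst z))" "continuous_on C (\<lambda>z. \<gamma> (fst z))"
    unfolding \<beta>_def \<gamma>_def
    by (intro continuous_on_max continuous_on_min continuous_on_diff continuous_on_mult
        continuous_on_const continuous_on_fst continuous_on_id)+
  have Sc: "continuous_on C (\<lambda>z. S z v)" for v
    unfolding S_def using m by (intro continuous_on_compose2[OF hc mc]) auto
  have "continuous_on C (\<lambda>z. h (r z) v)" "continuous_on C (\<lambda>z. t (m z) v)" for v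
    using m r by (auto intro: continuous_on_compose2[OF hc rc] continuous_on_compose2[OF tc mc])
  then have Tc: "continuous_on C (\<lambda>z. T z v)" for v
    unfolding T_def by (intro continuous_on_add continuous_on_mult continuous_on_diff continuous_on_const abc)
  have Sw: "weight_map (top_of_set C) N S"
    using W m hN nn Sc by (intro weight_mapI[of W1]) (auto simp: S_def)
  have bounds: "0 \<le> \<beta> u" "\<beta> u \<le> 1" "0 \<le> \<gamma> u" "\<gamma> u \<le> 1" if "0 \<le> u" "u \<le> 1" for u
    using that by (auto simp: \<beta>_def \<gamma>_def)
  have u: "0 \<le> fst z" "fst z \<le> 1" if "z \<in> C" for z
    using that by (auto simp: C_def)
  have pos: "0 < T z v \<longleftrightarrow> (\<gamma> (fst z) < 1 \<and> \<beta> (fst z) < 1 \<and> 0 < h (r z) v) \<or>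
      (\<gamma> (fst z) < 1 \<and> 0 < \<beta> (fst z) \<and> 0 < t (m z) v) \<or> (0 < \<gamma> (fst z) \<and> v = w0)" if z: "z \<in> C" for z v
  proof -
    have aux: "0 < (1 - c) * ((1 - b) * x + b * y) + c * of_bool P \<longleftrightarrow>
        (c < 1 \<and> b < 1 \<and> 0 < x) \<or> (c < 1 \<and> 0 < b \<and> 0 < y) \<or> (0 < c \<and> P)"
      if "0 \<le> b" "b \<le> 1" "0 \<le> c" "c \<le> 1" "0 \<le> x" "0 \<le> y" for b c x y :: real and P
    proof -
      have sum_pos: "0 < A + B \<longleftrightarrow> 0 < A \<or> 0 < B" if "0 \<le> A" "0 \<le> B" for A B :: real
        using that by linarith
      show ?thesis
        using that by (simp add: sum_pos zero_less_mult_iff) auto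
    qed
    show ?thesis
      unfolding T_def using bounds[OF u[OF z]] nn(1)[OF r[OF z]] nn(2)[OF m[OF z]] by (rule aux)
  qed
  have T_nonneg: "0 \<le> T z v" if z: "z \<in> C" for z v
    unfolding T_def using bounds[OF u[OF z]] nn(1)[OF r[OF z]] nn(2)[OF m[OF z]] by simp
  have adjST: "fully_adjacent (support (S z)) (support (T z))" if z: "z \<in> C" for z
    unfolding fully_adjacent_def
  proof (intro ballI)
    fix v v' assume v: "v \<in> support (S z)" and v': "v' \<in> support (T z)"
    obtain a x where ax: "z = (a, x)" "x \<in> Sph i" "0 \<le> a" "a \<le> 1"
      using z by (cases z) (auto simp: C_def)
    have v: "e < H (m z) v"
      using v supp_h[of "m z"] by (simp add: S_def set_eq_iff)
    consider "\<beta> a < 1" "0 < h (r z) v'" | "0 < t (m z) v'" | "0 < \<gamma> a" "v' = w0"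
      using v' pos[OF z] ax(1) by auto
    then show "adj v v'"
    proof cases
      case 1
      then have "\<alpha> a = 0" by (auto simp: \<alpha>_def \<beta>_def)
      then have "0 < s x v" using v e H(2) by (simp add: m_def ax(1))
      moreover have "0 < s (\<lambda>j. - x j) v'"
        using 1(2) supp_h[of "r z"] e H(2) by (simp add: r_def ax(1) set_eq_iff)
      ultimately show ?thesis
        using adj[OF ax(2)] by (simp add: fully_adjacent_def)
    next
      case 2
      then show ?thesis
        using tadj[OF m[OF z]] v by (simp add: fully_adjacent_def)
    next
      case 3
      then have "\<alpha> a = 1" by (auto simp: \<alpha>_def \<gamma>_def)
      then have "e < H (1, nsphere_base) v" using v H(3) by (simp add: m_def ax(1))
      then show ?thesis
        using tadj[OF bC] w0 3(2) by (simp add: fully_adjacent_def)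
    qed
  qed
  have "weight_map (top_of_set C) N T"
  proof (rule weight_mapI[of "insert w0 (W1 \<union> W2)"])
    fix z assume "z \<in> topspace (top_of_set C)"
    then have z: "z \<in> C" by simp
    show sub: "support (T z) \<subseteq> insert w0 (W1 \<union> W2)"
      using W(2)[OF r[OF z]] W(4)[OF m[OF z]] by (auto simp: pos[OF z])
    have ne: "support (T z) \<noteq> {}"
    proof -
      obtain v1 v2 where v: "0 < h (r z) v1" "0 < t (m z) v2"
        using simplex_nonempty[OF hN[OF r[OF z]]] simplex_nonempty[OF tN[OF m[OF z]]] by blast
      consider "\<gamma> (fst z) < 1" "\<beta> (fst z) < 1" | "\<gamma> (fst z) < 1" "0 < \<beta> (fst z)" | "0 < \<gamma> (fst z)"
        by linarith
      then have "0 < T z v1 \<or> 0 < T z v2 \<or> 0 < T z w0"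
        using v by cases (auto simp: pos[OF z])
      then show ?thesis by blast
    qed
    have "support (S z) \<in> N" using hN[OF m[OF z]] by (simp add: S_def)
    then show "support (T z) \<in> N"
    proof (rule fully_adjacent_simplex[OF adjST[OF z]])
      show "finite (support (T z))"
        using sub W(1,3) by (meson finite_UnI finite_insert finite_subset)
      show "support (T z) \<subseteq> V"
        using neighbourhood_complex_subset[OF hN[OF r[OF z]]] neighbourhood_complex_subset[OF tN[OF m[OF z]]] w0V
        by (auto simp: pos[OF z])
    qed (rule ne)
  next
    fix z v assume "z \<in> topspace (top_of_set C)"
    then show "0 \<le> T z v" using T_nonneg by simp
  next
    fix v show "continuous_map (top_of_set C) euclideanreal (\<lambda>z. T z v)"
      using Tc by simp
  qed (use W in auto)
  moreover have "T (0, x) = S (0, \<lambda>j. - x j)" for x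
    by (simp add: T_def S_def m_def r_def \<alpha>_def \<beta>_def \<gamma>_def)
  moreover have "fully_adjacent (support (S (0, x))) (support (S (0, \<lambda>j. - x j)))" if "x \<in> Sph i" for x
    using adj[OF that] e by (auto simp: fully_adjacent_def S_def m_def \<alpha>_def supp_h H(2))
  moreover have "S (1, x) = h (1, nsphere_base)" "T (1, x) = (\<lambda>v. of_bool (v = w0))" for x
    by (auto simp: S_def T_def m_def \<alpha>_def \<gamma>_def h_def H(3))
  ultimately show ?thesis
    using Sw adjST unfolding C_def[symmetric] by blast
qed

text \<open>The upper hemisphere carries \<open>S\<close> and the lower one carries \<open>T\<close> at the antipode, both in
  the polar coordinates of the projection to the equatorial ball.\<close>

lemma antipodally_adjacent_suspension:
  assumes "continuous_map (nsphere i) (geometric_realization N) s"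
    and "\<And>x. x \<in> Sph i \<Longrightarrow> fully_adjacent (support (s x)) (support (s (\<lambda>j. - x j)))"
    and "trivial_homotopy_group i (geometric_realization N)"
  shows "\<exists>s'. continuous_map (nsphere (Suc i)) (geometric_realization N) s' \<and>
    (\<forall>y\<in>Sph (Suc i). fully_adjacent (support (s' y)) (support (s' (\<lambda>j. - y j))))"
proof -
  define C where "C = {0..1::real} \<times> Sph i"
  obtain S T a b where w: "weight_map (top_of_set C) N S" "weight_map (top_of_set C) N T"
    and adj: "\<And>z. z \<in> C \<Longrightarrow> fully_adjacent (support (S z)) (support (T z))"
    and eq: "\<And>x. x \<in> Sph i \<Longrightarrow> T (0, x) = S (0, \<lambda>j. - x j)"
    and adj0: "\<And>x. x \<in> Sph i \<Longrightarrow> fully_adjacent (support (S (0, x))) (support (S (0, \<lambda>j. - x j)))"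
    and ab: "\<And>x. x \<in> Sph i \<Longrightarrow> S (1, x) = a" "\<And>x. x \<in> Sph i \<Longrightarrow> T (1, x) = b"
    using antipodally_adjacent_cylinder[OF assms] unfolding C_def by blast
  let ?neg = "\<lambda>y :: nat \<Rightarrow> real. \<lambda>j. - y j" and ?c = "cone_coord i"
  define g where "g = (\<lambda>y. if - y (Suc i) \<le> 0 then S (?c y) else T (?c (?neg y)))"
  have le1: "L2_set y {..i} \<le> 1" "L2_set (?neg y) {..i} \<le> 1" if "y \<in> Sph (Suc i)" for y
  proof -
    have "(\<Sum>j\<le>i. (y j)\<^sup>2) + (y (Suc i))\<^sup>2 = 1"
      using that by (simp add: nsphere)
    moreover have "0 \<le> (y (Suc i))\<^sup>2" by simp
    ultimately have "(\<Sum>j\<le>i. (y j)\<^sup>2) \<le> 1" by linarith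
    then show "L2_set y {..i} \<le> 1" "L2_set (?neg y) {..i} \<le> 1"
      by (simp_all add: L2_set_def)
  qed
  have cC: "?c y \<in> C" "?c (?neg y) \<in> C" if "y \<in> Sph (Suc i)" for y
    using cone_coord_mem le1[OF that] by (simp_all add: C_def)
  have equator: "y \<in> Sph i" if "y \<in> Sph (Suc i)" "y (Suc i) = 0" for y
    using topspace_nsphere_minus1[OF that] by simp
  have g0: "g y = S (0, y)" "T (?c (?neg y)) = S (0, y)" if "y \<in> Sph (Suc i)" "y (Suc i) = 0" for y
    using that equator[OF that] eq[of "?neg y"] antipode_in_nsphere[of y i]
    by (simp_all add: g_def cone_coord_sphere)
  obtain W1 W2 where W: "finite W1" "\<And>z. z \<in> C \<Longrightarrow> support (S z) \<subseteq> W1" "finite W2" "\<And>z. z \<in> C \<Longrightarrow> support (T z) \<subseteq> W2"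
    using w unfolding weight_map_def by auto
  have N: "support (S z) \<in> N" "support (T z) \<in> N" and nn: "0 \<le> S z v" "0 \<le> T z v" if "z \<in> C" for z v
    using w that by (auto simp: weight_map_def)
  have cont: "continuous_on (Sph (Suc i)) (\<lambda>y. g y v)" for v
  proof -
    have "continuous_on C (\<lambda>z. S z v)"
      using w by (simp add: weight_map_def)
    then have S: "continuous_on {z. L2_set z {..i} \<le> 1} (\<lambda>z. S (?c z) v)"
      unfolding C_def by (rule continuous_on_cone_coord) (simp add: ab nsphere_base_in_nsphere)
    have "continuous_on C (\<lambda>z. T z v)"
      using w by (simp add: weight_map_def)
    then have T: "continuous_on {z. L2_set z {..i} \<le> 1} (\<lambda>z. T (?c z) v)"
      unfolding C_def by (rule continuous_on_cone_coord) (simp add: ab nsphere_base_in_nsphere)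
    have coord: "continuous_on A (\<lambda>y::nat \<Rightarrow> real. y j)" for A j
      by (rule continuous_on_subset[OF continuous_on_product_coordinates]) simp
    have negc: "continuous_on A ?neg" for A
      by (intro continuous_on_coordinatewise_then_product continuous_on_minus coord)
    have "continuous_on (Sph (Suc i)) (\<lambda>y. if - y (Suc i) \<le> 0 then S (?c y) v else T (?c (?neg y)) v)"
    proof (rule continuous_on_cases_le)
      show "continuous_on {y \<in> Sph (Suc i). - y (Suc i) \<le> 0} (\<lambda>y. S (?c y) v)"
        by (rule continuous_on_subset[OF S]) (use le1 in auto)
      show "continuous_on {y \<in> Sph (Suc i). 0 \<le> - y (Suc i)} (\<lambda>y. T (?c (?neg y)) v)"
        by (rule continuous_on_compose2[OF T negc]) (use le1 in auto)
      show "continuous_on (Sph (Suc i)) (\<lambda>y. - y (Suc i))"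
        by (intro continuous_on_minus coord)
      show "S (?c y) v = T (?c (?neg y)) v" if "y \<in> Sph (Suc i)" "- y (Suc i) = 0" for y
        using g0[of y] that by (simp add: g_def)
    qed
    then show ?thesis
      by (rule continuous_on_eq) (simp add: g_def)
  qed
  have "weight_map (nsphere (Suc i)) N g"
    using W N nn cC cont
    by (intro weight_mapI[of "W1 \<union> W2"]) (auto simp: g_def continuous_map_nsphere_iff le_supI1 le_supI2)
  then have "continuous_map (nsphere (Suc i)) (geometric_realization N) (\<lambda>y. barycentric (g y))"
    by (rule weight_map_imp_continuous_map)
  moreover have "fully_adjacent (support (barycentric (g y))) (support (barycentric (g (?neg y))))"
    if y: "y \<in> Sph (Suc i)" for y
  proof -
    have gN: "support (g y) \<in> N" if "y \<in> Sph (Suc i)" for y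
      using \<open>weight_map (nsphere (Suc i)) N g\<close> that by (simp add: weight_map_def)
    have y': "?neg y \<in> Sph (Suc i)" using y by (simp add: antipode_in_nsphere)
    have "fully_adjacent (support (g y)) (support (g (?neg y)))"
    proof (cases "y (Suc i)" "0 :: real" rule: linorder_cases)
      case less
      then show ?thesis
        using fully_adjacent_sym[OF adj[OF cC(2)[OF y]]] by (simp add: g_def)
    next
      case equal
      then show ?thesis
        using g0(1)[OF y] g0(1)[OF y'] adj0[OF equator[OF y]] by simp
    next
      case greater
      then show ?thesis
        using adj[OF cC(1)[OF y]] by (simp add: g_def)
    qed
    then show ?thesis
      using gN y y' by simp
  qed
  ultimately show ?thesis by blast
qed

lemma antipodally_adjacent_sphere_exists:
  assumes edge: "a \<in> V" "b \<in> V" "adj a b" "a \<noteq> b"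
    and triv: "\<And>j. j < i \<Longrightarrow> trivial_homotopy_group j (geometric_realization N)"
  shows "\<exists>s. continuous_map (nsphere i) (geometric_realization N) s \<and>
    (\<forall>x\<in>Sph i. fully_adjacent (support (s x)) (support (s (\<lambda>j. - x j))))"
  using triv
proof (induction i)
  case 0
  define g where "g = (\<lambda>(x :: nat \<Rightarrow> real) v. (1 + x 0) / 2 * of_bool (v = a) + (1 - x 0) / 2 * of_bool (v = b))"
  have g: "x 0 = 1 \<and> support (g x) = {a} \<or> x 0 = -1 \<and> support (g x) = {b}" if "x \<in> Sph 0" for x
  proof -
    have "x 0 = 1 \<or> x 0 = -1"
      using that by (simp add: nsphere power2_eq_1_iff)
    then show ?thesis using edge(4) by (auto simp: g_def)
  qed
  have ab: "{a} \<in> N" "{b} \<in> N"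
    using edge adj_sym by (auto simp: neighbourhood_complex_def)
  have w: "weight_map (nsphere 0) N g"
  proof (rule weight_mapI[of "{a, b}"])
    fix x assume x: "x \<in> Sph 0"
    show "support (g x) \<subseteq> {a, b}" "support (g x) \<in> N"
      using g[OF x] ab by auto
    have "\<bar>x 0\<bar> \<le> 1" using g[OF x] by auto
    then show "0 \<le> g x v" for v by (auto simp: g_def)
  next
    fix v
    show "continuous_map (nsphere 0) euclideanreal (\<lambda>x. g x v)"
      unfolding g_def continuous_map_nsphere_iff
      by (intro continuous_on_add continuous_on_mult continuous_on_divide continuous_on_diff continuous_on_const
          continuous_on_subset[OF continuous_on_product_coordinates]) auto
  qed simp
  have "fully_adjacent (support (barycentric (g x))) (support (barycentric (g (\<lambda>j. - x j))))" if x: "x \<in> Sph 0" for x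
  proof -
    have x': "(\<lambda>j. - x j) \<in> Sph 0" using x by (simp add: antipode_in_nsphere)
    have "support (g x) \<in> N" "support (g (\<lambda>j. - x j)) \<in> N"
      using w x x' by (auto simp: weight_map_def)
    moreover have "fully_adjacent {a} {b}" "fully_adjacent {b} {a}"
      using edge(3) adj_sym by (auto simp: fully_adjacent_def)
    moreover have "support (g x) = {a} \<and> support (g (\<lambda>j. - x j)) = {b} \<or> support (g x) = {b} \<and> support (g (\<lambda>j. - x j)) = {a}"
    proof (cases "x 0 = 1")
      case True
      then have "support (g x) = {a}" "support (g (\<lambda>j. - x j)) = {b}"
        using g[OF x] g[OF x'] by argo+
      then show ?thesis by blast
    next
      case False
      then have "support (g x) = {b}" "support (g (\<lambda>j. - x j)) = {a}"
        using g[OF x] g[OF x'] by argo+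
      then show ?thesis by blast
    qed
    ultimately show ?thesis
      by (elim disjE conjE) simp_all
  qed
  then show ?case
    using weight_map_imp_continuous_map[OF w] by blast
next
  case (Suc i)
  then obtain s where "continuous_map (nsphere i) (geometric_realization N) s"
      "\<And>x. x \<in> Sph i \<Longrightarrow> fully_adjacent (support (s x)) (support (s (\<lambda>j. - x j)))"
    by (metis less_SucI)
  then show ?case
    by (rule antipodally_adjacent_suspension) (use Suc.prems in auto)
qed

text \<open>The bound of Lovasz for the chromatic number. Borsuk--Ulam annihilates the colour differences \<open>h j\<close>
  of an antipodally adjacent sphere for \<open>j < k\<close>; the last one vanishes because all of them sum to zero. So a
  colour in the carrier of \<open>s x\<close> recurs in that of \<open>s (- x)\<close>.\<close>

theorem Lovasz_bound:
  fixes c :: "'v \<Rightarrow> nat"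
  assumes edge: "a \<in> V" "b \<in> V" "adj a b"
    and triv: "\<And>i. i < k \<Longrightarrow> trivial_homotopy_group i (geometric_realization N)"
    and c: "\<And>v. v \<in> V \<Longrightarrow> c v \<le> k"
  shows "\<exists>u\<in>V. \<exists>v\<in>V. adj u v \<and> c u = c v"
proof (cases "a = b")
  case True
  then show ?thesis using edge by blast
next
  case False
  let ?neg = "\<lambda>x :: nat \<Rightarrow> real. \<lambda>j. - x j"
  obtain s where s: "continuous_map (nsphere k) (geometric_realization N) s"
      "\<And>x. x \<in> Sph k \<Longrightarrow> fully_adjacent (support (s x)) (support (s (?neg x)))"
    using antipodally_adjacent_sphere_exists[OF edge False triv] by blast
  have w: "weight_map (nsphere k) N s"
    by (rule continuous_map_imp_weight_map[OF compact_space_nsphere s(1)])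
  then obtain W where W: "finite W" "\<And>x. x \<in> Sph k \<Longrightarrow> support (s x) \<subseteq> W"
    by (auto simp: weight_map_def)
  have nn: "0 \<le> s x v" and sN: "support (s x) \<in> N" if "x \<in> Sph k" for x v
    using w that by (auto simp: weight_map_def)
  have sc: "continuous_map (nsphere k) euclideanreal (\<lambda>x. s x v)" for v
    using w by (simp add: weight_map_def)
  define U where "U = W \<inter> V"
  have U: "finite U" "\<And>x. x \<in> Sph k \<Longrightarrow> support (s x) \<subseteq> U" "c ` U \<subseteq> {..k}"
    using W neighbourhood_complex_subset[OF sN] c by (auto simp: U_def)
  have one: "sum (s x) U = 1" if x: "x \<in> Sph k" for x
    using sum_support[OF U(1) U(2)[OF x] nn[OF x]] s(1) x
    by (auto simp: continuous_map_def mem_realization Pi_iff)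
  have neg: "?neg x \<in> Sph k" if "x \<in> Sph k" for x
    using that by (simp add: antipode_in_nsphere)
  define m where "m = (\<lambda>j x. sum (s x) {v \<in> U. c v = j})"
  define h where "h = (\<lambda>j x. m j x - m j (?neg x))"
  have total: "(\<Sum>j\<le>k. m j x) = 1" if "x \<in> Sph k" for x
    using sum.group[OF U(1) finite_atMost U(3), of "s x"] one[OF that] by (simp add: m_def)
  have mc: "continuous_map (nsphere k) euclideanreal (m j)" for j
    unfolding m_def using U(1) by (intro continuous_map_sum sc) auto
  have "continuous_map (nsphere k) euclideanreal (\<lambda>x. m j (?neg x))" for j
    using continuous_map_compose[OF continuous_map_antipode mc] by (simp add: o_def)
  then have hc: "continuous_map (nsphere k) euclideanreal (h j)" for j
    unfolding h_def by (intro continuous_map_diff mc)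
  obtain x where x: "x \<in> Sph k" "\<And>j. j < k \<Longrightarrow> h j x = 0"
    using Borsuk_Ulam[of k h] hc by (auto simp: h_def)
  have "(\<Sum>j\<le>k. h j x) = 0"
    using total[OF x(1)] total[OF neg[OF x(1)]] by (simp add: h_def sum_subtractf)
  moreover have "(\<Sum>j<k. h j x) = 0" using x(2) by simp
  ultimately have "h k x = 0" by (simp add: lessThan_Suc_atMost[symmetric])
  then have h0: "h j x = 0" if "j \<le> k" for j
    using x(2) that by (cases "j = k") auto
  obtain u where u: "u \<in> support (s x)"
    using simplex_nonempty[OF sN[OF x(1)]] by blast
  then have uU: "u \<in> U" using U(2)[OF x(1)] by blast
  have "s x u \<le> m (c u) x"
    unfolding m_def using uU U(1) nn[OF x(1)] by (intro member_le_sum) auto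
  then have "0 < m (c u) (?neg x)"
    using h0[of "c u"] u uU U(3) by (auto simp: h_def)
  then obtain v where v: "v \<in> U" "c v = c u" "0 < s (?neg x) v"
    unfolding m_def using sum_nonpos[of "{v \<in> U. c v = c u}" "s (?neg x)"] by (force simp: not_less)
  have "adj u v"
    using s(2)[OF x(1)] u v(3) by (simp add: fully_adjacent_def)
  then show ?thesis
    using uU v(1,2) unfolding U_def by (metis Int_iff)
qed

end

section \<open>Cech complexes of the sphere\<close>

text \<open>The supremum that defines \<^const>\<open>conn\<close> is over integers, and one of them that exceeds \<open>k - 2\<close>
  is at least \<open>k - 1\<close>.\<close>

lemma conn_eq_imp_trivial:
  assumes "conn Y = ereal (real k - 1)" "i < k"
  shows "trivial_homotopy_group i Y"
proof -
  have "ereal (real k - 2) < conn Y" by (simp add: assms(1))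
  then obtain j :: int where "ereal (real k - 2) < ereal (real_of_int j)" "\<And>i. int i \<le> j \<Longrightarrow> trivial_homotopy_group i Y"
    unfolding conn_def less_Sup_iff by blast
  moreover from this have "int i \<le> j" using assms(2) by simp
  ultimately show ?thesis by blast
qed

lemma conn_eq_imp_nontrivial:
  assumes "conn Y = ereal (real k - 1)"
  shows "\<exists>i\<le>k. \<not> trivial_homotopy_group i Y"
proof (rule ccontr)
  assume "\<not> ?thesis"
  then have "ereal (real_of_int (int k)) \<le> conn Y"
    unfolding conn_def by (intro Sup_upper) (auto intro!: exI[of _ "int k"])
  then show False by (simp add: assms)
qed

lemma covering_radius_le:
  assumes "0 \<le> r" "\<And>i. i \<in> {1..m} \<Longrightarrow> x i \<in> mspace X" "mspace X \<subseteq> (\<Union>i\<in>{1..m}. mcball_of X (x i) r)"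
  shows "covering_radius X m \<le> r"
  unfolding covering_radius_def
proof (rule cInf_lower)
  have "(\<Union>i\<in>{1..m}. mcball_of X (x i) r) = mspace X"
    using assms(3) by auto
  then show "r \<in> {r. 0 \<le> r \<and> (\<exists>x. (\<forall>i\<in>{1..m}. x i \<in> mspace X) \<and> (\<Union>i\<in>{1..m}. mcball_of X (x i) r) = mspace X)}"
    using assms by blast
qed (auto intro!: bdd_belowI[of _ 0])

lemma ex_surj_of_card_le:
  assumes "finite A" "finite B" "B \<noteq> {}" "card B \<le> card A"
  shows "\<exists>f. f ` A = B"
proof -
  obtain h where h: "h ` B \<subseteq> A" "inj_on h B"
    using card_le_inj[OF assms(2,1,4)] by blast
  obtain b where b: "b \<in> B" using assms(3) by blast
  have "(\<lambda>a. if a \<in> h ` B then inv_into B h a else b) ` A = B"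
  proof (intro equalityI subsetI)
    fix y assume "y \<in> B"
    then show "y \<in> (\<lambda>a. if a \<in> h ` B then inv_into B h a else b) ` A"
      using h by (intro image_eqI[of _ _ "h y"]) auto
  qed (use b h(2) in auto)
  then show ?thesis by blast
qed

text \<open>The witness \<open>w\<close> is the antipode of a common point of the open balls.\<close>

lemma cech_complex_sphere_iff:
  fixes \<sigma> :: "'a::real_inner set"
  shows "\<sigma> \<in> cech_complex geodesic_sphere (pi - \<delta>) \<longleftrightarrow>
    finite \<sigma> \<and> \<sigma> \<noteq> {} \<and> \<sigma> \<subseteq> sphere 0 1 \<and> (\<exists>w\<in>sphere 0 1. \<forall>x\<in>\<sigma>. \<delta> < arccos (x \<bullet> w))"
proof -
  have ball: "z \<in> mball_of geodesic_sphere x (pi - \<delta>) \<longleftrightarrow> z \<in> sphere 0 1 \<and> \<delta> < arccos (x \<bullet> (- z))"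
    if "x \<in> sphere 0 1" for x z :: 'a
    using that inner_sphere_bounds[of x z] by (auto simp: arccos_minus)
  have neg: "- z \<in> sphere 0 1 \<longleftrightarrow> z \<in> sphere 0 1" for z :: 'a by simp
  have "(\<Inter>x\<in>\<sigma>. mball_of geodesic_sphere x (pi - \<delta>)) \<noteq> {} \<longleftrightarrow> (\<exists>w\<in>sphere 0 1. \<forall>x\<in>\<sigma>. \<delta> < arccos (x \<bullet> w))"
    if "\<sigma> \<noteq> {}" "\<sigma> \<subseteq> sphere 0 1"
  proof
    assume "(\<Inter>x\<in>\<sigma>. mball_of geodesic_sphere x (pi - \<delta>)) \<noteq> {}"
    then obtain z where "\<forall>x\<in>\<sigma>. z \<in> mball_of geodesic_sphere x (pi - \<delta>)" by blast
    then have "z \<in> sphere 0 1" "\<forall>x\<in>\<sigma>. \<delta> < arccos (x \<bullet> (- z))"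
      using ball that by blast+
    then show "\<exists>w\<in>sphere 0 1. \<forall>x\<in>\<sigma>. \<delta> < arccos (x \<bullet> w)"
      using neg by blast
  next
    assume "\<exists>w\<in>sphere 0 1. \<forall>x\<in>\<sigma>. \<delta> < arccos (x \<bullet> w)"
    then obtain w where "w \<in> sphere 0 1" "\<forall>x\<in>\<sigma>. \<delta> < arccos (x \<bullet> (- (- w)))" by auto
    then have "\<forall>x\<in>\<sigma>. - w \<in> mball_of geodesic_sphere x (pi - \<delta>)"
      using ball neg that(2) by blast
    then show "(\<Inter>x\<in>\<sigma>. mball_of geodesic_sphere x (pi - \<delta>)) \<noteq> {}" by blast
  qed
  then show ?thesis by (auto simp: cech_complex_def)
qed

lemma mcball_of_geodesic_sphere:
  "x \<in> sphere 0 1 \<Longrightarrow> mcball_of geodesic_sphere x r = {y \<in> sphere 0 1. arccos (x \<bullet> y) \<le> r}"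
  by auto

interpretation borsuk_graph: symmetric_graph "sphere 0 1 :: 'a::real_inner set" "\<lambda>u v. \<delta> < arccos (u \<bullet> v)" for \<delta>
  by unfold_locales (simp add: inner_commute)

lemma cech_complex_sphere_eq:
  "cech_complex geodesic_sphere (pi - \<delta>) = borsuk_graph.neighbourhood_complex \<delta>"
  unfolding borsuk_graph.neighbourhood_complex_def set_eq_iff mem_Collect_eq cech_complex_sphere_iff by blast

proposition covering_radius_le_of_nontrivial_homotopy:
  assumes \<delta>: "0 \<le> \<delta>" and nontriv: "\<not> trivial_homotopy_group i (geometric_realization (cech_complex (geodesic_sphere :: 'a::real_inner metric) (pi - \<delta>)))"
    and m: "i + 2 \<le> m"
  shows "covering_radius (geodesic_sphere :: 'a metric) m \<le> \<delta>"
proof (rule ccontr)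
  assume gt: "\<not> ?thesis"
  let ?K = "cech_complex (geodesic_sphere :: 'a metric) (pi - \<delta>)"
  have "\<sigma> \<in> ?K" if \<sigma>: "finite \<sigma>" "\<sigma> \<noteq> {}" "\<sigma> \<subseteq> \<Union>?K" "card \<sigma> \<le> i + 2" for \<sigma>
  proof -
    have sub: "\<sigma> \<subseteq> sphere 0 1"
      using \<sigma>(3) unfolding cech_complex_sphere_eq borsuk_graph.neighbourhood_complex_def by blast
    obtain x where x: "x ` {1..m} = \<sigma>"
      using ex_surj_of_card_le[of "{1..m}" \<sigma>] \<sigma> m by auto
    have xs: "x j \<in> sphere 0 1" if "j \<in> {1..m}" for j
      using that x sub by blast
    have "\<not> sphere 0 1 \<subseteq> (\<Union>j\<in>{1..m}. mcball_of geodesic_sphere (x j) \<delta>)"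
      using covering_radius_le[OF \<delta>, of m x geodesic_sphere] xs gt by auto
    then obtain w where "w \<in> sphere 0 1" "\<And>j. j \<in> {1..m} \<Longrightarrow> w \<notin> mcball_of geodesic_sphere (x j) \<delta>"
      by blast
    then have "w \<in> sphere 0 1" "\<forall>y\<in>\<sigma>. \<delta> < arccos (y \<bullet> w)"
      using x xs by (auto simp: mcball_of_geodesic_sphere not_le)
    then show ?thesis
      using \<sigma> sub by (auto simp: cech_complex_sphere_iff)
  qed
  then show False
    using nontriv borsuk_graph.trivial_homotopy_group_full_skeleton[of \<delta> i] unfolding cech_complex_sphere_eq by blast
qed

proposition le_twice_covering_radius_of_trivial_homotopy:
  assumes \<delta>: "\<delta> < pi" and ne: "sphere 0 1 \<noteq> ({} :: 'a::real_inner set)"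
    and triv: "\<And>i. i < k \<Longrightarrow> trivial_homotopy_group i (geometric_realization (cech_complex (geodesic_sphere :: 'a metric) (pi - \<delta>)))"
  shows "\<delta> \<le> 2 * covering_radius (geodesic_sphere :: 'a metric) (k + 1)"
proof (rule ccontr)
  assume "\<not> ?thesis"
  then have lt: "covering_radius (geodesic_sphere :: 'a metric) (k + 1) < \<delta> / 2" by simp
  obtain a :: 'a where a: "a \<in> sphere 0 1" using ne by blast
  let ?R = "{r. 0 \<le> r \<and> (\<exists>x :: nat \<Rightarrow> 'a. (\<forall>i\<in>{1..k + 1}. x i \<in> mspace geodesic_sphere) \<and>
      (\<Union>i\<in>{1..k + 1}. mcball_of geodesic_sphere (x i) r) = mspace geodesic_sphere)}"
  \<comment> \<open>the set of admissible radii is nonempty, so its infimum is approximated by its elements\<close>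
  have "mcball_of geodesic_sphere a pi = sphere 0 1"
    using a inner_sphere_bounds[OF a] arccos_ubound by (auto simp: mcball_of_geodesic_sphere)
  then have "pi \<in> ?R"
    using a by (auto intro!: exI[of _ "\<lambda>_. a"])
  then have "\<exists>r\<in>?R. r < \<delta> / 2"
    using lt unfolding covering_radius_def by (intro cInf_lessD) blast+
  then obtain r and x :: "nat \<Rightarrow> 'a" where r: "0 \<le> r" "r < \<delta> / 2"
    and x: "\<And>i. i \<in> {1..k + 1} \<Longrightarrow> x i \<in> sphere 0 1"
    and cov: "(\<Union>i\<in>{1..k + 1}. mcball_of geodesic_sphere (x i) r) = sphere 0 1"
    unfolding mspace_geodesic_sphere by blast
  have "\<exists>i\<in>{1..k + 1}. v \<in> mcball_of geodesic_sphere (x i) r" if "v \<in> sphere 0 1" for v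
    using cov that by blast
  then obtain i where i: "\<And>v. v \<in> sphere 0 1 \<Longrightarrow> i v \<in> {1..k + 1} \<and> v \<in> mcball_of geodesic_sphere (x (i v)) r"
    by metis
  have near: "arccos (x (i v) \<bullet> v) \<le> r" if "v \<in> sphere 0 1" for v
    using i[OF that] x by (auto simp: mcball_of_geodesic_sphere)
  have edge: "\<delta> < arccos (a \<bullet> (- a))"
    using a \<delta> by (simp add: norm_eq_1)
  \<comment> \<open>the balls are numbered from 1, the colours from 0\<close>
  have "\<exists>u\<in>sphere 0 1. \<exists>v\<in>sphere 0 1. \<delta> < arccos (u \<bullet> v) \<and> i u - 1 = i v - 1"
    using triv edge a i unfolding cech_complex_sphere_eq
    by (intro borsuk_graph.Lovasz_bound[where a = a and b = "- a" and k = k]) force+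
  then obtain u v where uv: "u \<in> sphere 0 1" "v \<in> sphere 0 1" "\<delta> < arccos (u \<bullet> v)" "i u - 1 = i v - 1"
    by blast
  have "i u = i v" using uv i[OF uv(1)] i[OF uv(2)] by auto
  define y where "y = x (i u)"
  have y: "y \<in> sphere 0 1" using x i[OF uv(1)] by (auto simp: y_def)
  have "geodesic_dist u v \<le> geodesic_dist u y + geodesic_dist y v"
    using Metric_space.triangle[OF Metric_space_geodesic] uv y by blast
  then have "arccos (u \<bullet> v) \<le> arccos (y \<bullet> u) + arccos (y \<bullet> v)"
    using uv y by (simp add: geodesic_dist_def inner_commute)
  also have "\<dots> \<le> 2 * r"
    using near[OF uv(1)] near[OF uv(2)] \<open>i u = i v\<close> by (simp add: y_def)
  finally show False using r uv(3) by simp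
qed

theorem theorem1p1:
  fixes n k :: nat and \<delta> :: real
  assumes "n \<ge> 1" and "CARD('d::finite) = n + 1"
    and "0 < \<delta>" and "\<delta> < pi"
    and "conn (geometric_realization (cech_complex (geodesic_sphere :: (real ^ 'd) metric) (pi - \<delta>)))
           = ereal (real k - 1)"
  shows "covering_radius (geodesic_sphere :: (real ^ 'd) metric) (2 * k + 2) \<le> \<delta> \<and>
         \<delta> \<le> 2 * covering_radius (geodesic_sphere :: (real ^ 'd) metric) (k + 1)"
proof
  obtain i where i: "i \<le> k"
      "\<not> trivial_homotopy_group i (geometric_realization (cech_complex (geodesic_sphere :: (real ^ 'd) metric) (pi - \<delta>)))"
    using conn_eq_imp_nontrivial[OF assms(5)] by blast
  then show "covering_radius (geodesic_sphere :: (real ^ 'd) metric) (2 * k + 2) \<le> \<delta>"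
    using assms(3) by (intro covering_radius_le_of_nontrivial_homotopy) auto
  have "sphere 0 1 \<noteq> ({} :: (real ^ 'd) set)" by simp
  then show "\<delta> \<le> 2 * covering_radius (geodesic_sphere :: (real ^ 'd) metric) (k + 1)"
    using assms(4) conn_eq_imp_trivial[OF assms(5)] by (intro le_twice_covering_radius_of_trivial_homotopy)
qed

end
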